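(* Let $\Phi,\Psi\in\mathbb{C}^{n\times n}$ be simultaneously diagonalizable, with (invertible) shared eigenvector matrix $U$, and consider linear two-level AT-MGRIT with fine time integrator $\Phi$, coarse time integrator $\Psi$, coarsening factor $m$ and local coarse-grid size $k$, with error-propagation operator $\mathcal{E}$ as defined in the context. Order the time points by the CF-splitting ($F$-points first, then $C$-points), and partition $\mathcal{E}$ accordingly. Then for every integer $\ell\ge 1$, error propagation takes the form $$\mathcal{E}^\ell = \begin{bmatrix} \mathcal{E}_{ff} & \mathcal{E}_{fc} \\ \mathcal{E}_{cf} & \mathcal{E}_{cc}\end{bmatrix}^\ell = \begin{bmatrix} \mathbf{0} & \mathcal{E}_{fc}\,\mathcal{E}_{cc}^{\ell-1} \\ \mathbf{0} & \mathcal{E}_{cc}^{\ell}\end{bmatrix}.$$ Further, assume that $\Phi$ and $\Psi$ are stable in an eigenvalue sense, that is, $|\mu|<1$ for all $\mu\in\sigma(\Psi)$ and $|\lambda|<1$ for all $\lambda\in\sigma(\Phi)$. Then $$\|\mathcal{E}_{cc}\|_{(\widetilde{U}\widetilde{U}^* )^{-1}} \;\le\; \max_{\{\mu,\lambda\}} \left( \frac{|\lambda^{m}-\mu|\,\bigl(1-|\mu|^{k-1}\bigr)}{1-|\mu|} + |\lambda^{m}\mu^{k-1}| \right),$$ where the maximum is over all pairs $\{\mu,\lambda\}$ of eigenvalues $\mu\in\sigma(\Psi)$, $\lambda\in\sigma(\Phi)$ associated with the same shared eigenvector (column of $U$).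
   Context: **Time grids.** Let $m>1$ be an integer (coarsening factor), and consider fine time points $t_0,\dots,t_{N_t}$ with $N_t+1=m(N_T+1)$. The points $t_{pm}$, $p=0,\dots,N_T$, are called $C$-points; all other points are $F$-points, so each $C$-point is followed by $m-1$ $F$-points. Let $k$ be an integer with $1\le k\le N_T+1$. For $p=0,\dots,N_T$, the $p$-th local coarse grid consists of the $C$-points with indices $i\in[\max(0,p-k+1),\,p]$; it has $\min(p+1,k)$ points. **Operators.** All matrices below are block matrices with $n\times n$ blocks. The matrix $\Phi$ is the (linear, time-independent) fine one-step time integrator, and $\Psi$ is the coarse time integrator, used as an approximation of $\Phi^m$. - $A$ is the $(N_t+1)\times(N_t+1)$ block lower bidiagonal matrix with identity blocks $I$ on the diagonal and $-\Phi$ on the first block subdiagonal. - $R_I$ is restriction by injection from all time points to all $C$-points (it selects the block entries at the $N_T+1$ $C$-points). - $P$ is ideal interpolation, $P = I_{N_T+1}\otimes [\,I;\Phi;\dots;\Phi^{m-1}\,]$ (block column), mapping values $(v_p)_{p=0}^{N_T}$ at $C$-points to the fine-grid vector with block entry $\Phi^{j}v_p$ at $t_{pm+j}$, $0\le j\le m-1$. - $R_I^{(p)}$ is restriction by injection from all time points to the $C$-points of the $p$-th local coarse grid. - $\widetilde{A}_c^{(p)}$ is the $\min(p+1,k)\times\min(p+1,k)$ block lower bidiagonal matrix with $I$ on the diagonal and $-\Psi$ on the first block subdiagonal (approximate local coarse-grid operator). - $P_S^{(p)}$ is selective ideal interpolation from the $p$-th local coarse grid to the fine grid. It has $\min(p+1,k)$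 block columns, all zero except the last, and the last block column has blocks $I,\Phi,\dots,\Phi^{m-1}$ in block rows $pm,pm+1,\dots,pm+m-1$ (numbered from $0$) and zeros elsewhere. **Error propagation.** The error-propagation operator of one iteration of two-level AT-MGRIT (with $F$-relaxation and the approximate local coarse grids) is $$\mathcal{E} = \Bigl(I-\sum_{p=0}^{N_T} P_S^{(p)}\bigl(\widetilde{A}_c^{(p)}\bigr)^{-1}R_I^{(p)}A\Bigr)PR_I .$$ After reordering the time points so that $F$-points come first and $C$-points second, $\mathcal{E}$ is partitioned as $\begin{bmatrix}\mathcal{E}_{ff}&\mathcal{E}_{fc}\\ \mathcal{E}_{cf}&\mathcal{E}_{cc}\end{bmatrix}$, where subscripts $f$ and $c$ denote $F$- and $C$-points. Thus $\mathcal{E}_{cc}$ is an $(N_T+1)\times(N_T+1)$ block matrix. **Norm.** $\widetilde{U}$ is the block-diagonal matrix with $N_T+1$ diagonal blocks, each equal to $U$. For a Hermitian positive definite matrix $M$, $\|\cdot\|_M$ is the operator norm induced by the vector norm $\|x\|_M=\sqrt{x^*Mx}$. The spectrum of a matrix is denoted by $\sigma(\cdot)$. *)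

theory Defs
  imports "Jordan_Normal_Form.Spectral_Radius"
begin

text \<open>The matrix with \<open>r \<times> c\<close> blocks of size \<open>n \<times> n\<close>, whose \<open>(i,j)\<close> block is \<open>B i j\<close>.
  Block \<open>i\<close> occupies the scalar indices \<open>i * n, \<dots>, i * n + n - 1\<close>.\<close>

definition block_mat :: "nat \<Rightarrow> nat \<Rightarrow> nat \<Rightarrow> (nat \<Rightarrow> nat \<Rightarrow> complex mat) \<Rightarrow> complex mat" where
  "block_mat n r c B =
     Matrix.mat (r * n) (c * n) (\<lambda>(i, j). B (i div n) (j div n) $$ (i mod n, j mod n))"

definition block_at :: "nat \<Rightarrow> complex mat \<Rightarrow> nat \<Rightarrow> nat \<Rightarrow> complex mat" where
  "block_at n X i j = Matrix.mat n n (\<lambda>(a, b). X $$ (i * n + a, j * n + b))"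

text \<open>Summation over \<open>nr \<times> nc\<close> matrices; the monoid operation of \<^const>\<open>monoid_mat\<close> is addition
  (compare \<^const>\<open>finsum_vec\<close>).\<close>

definition finsum_mat :: "nat \<Rightarrow> nat \<Rightarrow> ('i \<Rightarrow> complex mat) \<Rightarrow> 'i set \<Rightarrow> complex mat" where
  "finsum_mat nr nc = finprod (monoid_mat TYPE(complex) nr nc)"

text \<open>Only meaningful for invertible matrices.\<close>

abbreviation mat_inv :: "complex mat \<Rightarrow> complex mat" where
  "mat_inv X \<equiv> the (mat_inverse X)"

text \<open>\<open>x\<^sup>* M x\<close> is real for Hermitian \<open>M\<close>; \<open>y \<bullet>c x\<close> conjugates its second argument.\<close>

definition weighted_vec_norm :: "complex mat \<Rightarrow> complex vec \<Rightarrow> real" where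
  "weighted_vec_norm M x = sqrt (Re ((M *\<^sub>v x) \<bullet>c x))"

text \<open>For Hermitian positive definite \<open>M\<close> and a nonempty square matrix \<open>X\<close> of the same size,
  the supremum is over a nonempty bounded set.\<close>

definition weighted_op_norm :: "complex mat \<Rightarrow> complex mat \<Rightarrow> real" where
  "weighted_op_norm M X =
     (SUP x \<in> carrier_vec (dim_col X) - {0\<^sub>v (dim_col X)}.
        weighted_vec_norm M (X *\<^sub>v x) / weighted_vec_norm M x)"

definition simultaneously_diagonalized_by ::
    "complex mat \<Rightarrow> complex mat \<Rightarrow> complex mat \<Rightarrow> bool" where
  "simultaneously_diagonalized_by \<Phi> \<Psi> U \<longleftrightarrow>
     (\<exists>V D\<^sub>\<Phi> D\<^sub>\<Psi>. diagonal_mat D\<^sub>\<Phi> \<and> diagonal_mat D\<^sub>\<Psi> \<and>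
        similar_mat_wit \<Phi> D\<^sub>\<Phi> U V \<and> similar_mat_wit \<Psi> D\<^sub>\<Psi> U V)"

definition shared_eigenpairs ::
    "complex mat \<Rightarrow> complex mat \<Rightarrow> complex mat \<Rightarrow> (complex \<times> complex) set" where
  "shared_eigenpairs \<Phi> \<Psi> U =
     {(\<mu>, lam). \<exists>j < dim_col U. eigenvector \<Psi> (col U j) \<mu> \<and> eigenvector \<Phi> (col U j) lam}"

text \<open>Throughout, \<open>Nt\<close> and \<open>NT\<close> are the last fine and coarse time indices, so there are
  \<open>Nt + 1\<close> fine points and \<open>NT + 1\<close> C-points.\<close>

definition fine_op :: "nat \<Rightarrow> nat \<Rightarrow> complex mat \<Rightarrow> complex mat" where
  "fine_op n Nt \<Phi> = block_mat n (Nt + 1) (Nt + 1)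
     (\<lambda>i j. if i = j then 1\<^sub>m n else if i = j + 1 then - \<Phi> else 0\<^sub>m n n)"

definition restrict_C :: "nat \<Rightarrow> nat \<Rightarrow> nat \<Rightarrow> nat \<Rightarrow> complex mat" where
  "restrict_C n m Nt NT = block_mat n (NT + 1) (Nt + 1)
     (\<lambda>p j. if j = p * m then 1\<^sub>m n else 0\<^sub>m n n)"

definition ideal_interp :: "nat \<Rightarrow> nat \<Rightarrow> nat \<Rightarrow> nat \<Rightarrow> complex mat \<Rightarrow> complex mat" where
  "ideal_interp n m Nt NT \<Phi> = block_mat n (Nt + 1) (NT + 1)
     (\<lambda>i p. if i div m = p then \<Phi> ^\<^sub>m (i mod m) else 0\<^sub>m n n)"

text \<open>The \<open>p\<close>-th local coarse grid consists of the C-points with indices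
  \<open>local_start k p, \<dots>, p\<close>; subtraction on \<^typ>\<open>nat\<close> truncates at 0.\<close>

definition local_start :: "nat \<Rightarrow> nat \<Rightarrow> nat" where
  "local_start k p = p + 1 - k"

definition local_size :: "nat \<Rightarrow> nat \<Rightarrow> nat" where
  "local_size k p = min (p + 1) k"

definition local_restrict :: "nat \<Rightarrow> nat \<Rightarrow> nat \<Rightarrow> nat \<Rightarrow> nat \<Rightarrow> complex mat" where
  "local_restrict n m Nt k p = block_mat n (local_size k p) (Nt + 1)
     (\<lambda>i j. if j = (local_start k p + i) * m then 1\<^sub>m n else 0\<^sub>m n n)"

definition local_coarse_op :: "nat \<Rightarrow> nat \<Rightarrow> nat \<Rightarrow> complex mat \<Rightarrow> complex mat" where
  "local_coarse_op n k p \<Psi> = block_mat n (local_size k p) (local_size k p)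
     (\<lambda>i j. if i = j then 1\<^sub>m n else if i = j + 1 then - \<Psi> else 0\<^sub>m n n)"

definition selective_interp ::
    "nat \<Rightarrow> nat \<Rightarrow> nat \<Rightarrow> nat \<Rightarrow> nat \<Rightarrow> complex mat \<Rightarrow> complex mat" where
  "selective_interp n m Nt k p \<Phi> = block_mat n (Nt + 1) (local_size k p)
     (\<lambda>i j. if j + 1 = local_size k p \<and> p * m \<le> i \<and> i < p * m + m
            then \<Phi> ^\<^sub>m (i - p * m) else 0\<^sub>m n n)"

definition error_op ::
    "nat \<Rightarrow> nat \<Rightarrow> nat \<Rightarrow> nat \<Rightarrow> nat \<Rightarrow> complex mat \<Rightarrow> complex mat \<Rightarrow> complex mat" where
  "error_op n m Nt NT k \<Phi> \<Psi> =
     (let N = (Nt + 1) * n in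
      (1\<^sub>m N -
       finsum_mat N N
         (\<lambda>p. selective_interp n m Nt k p \<Phi> * mat_inv (local_coarse_op n k p \<Psi>)
              * local_restrict n m Nt k p * fine_op n Nt \<Phi>) {0..NT})
      * (ideal_interp n m Nt NT \<Phi> * restrict_C n m Nt NT))"

definition F_points :: "nat \<Rightarrow> nat \<Rightarrow> nat list" where
  "F_points m Nt = filter (\<lambda>i. \<not> m dvd i) [0..<Nt + 1]"

definition C_points :: "nat \<Rightarrow> nat \<Rightarrow> nat list" where
  "C_points m Nt = filter (\<lambda>i. m dvd i) [0..<Nt + 1]"

text \<open>Symmetric reordering of the block rows and block columns, F-points first.\<close>

definition cf_reorder :: "nat \<Rightarrow> nat \<Rightarrow> nat \<Rightarrow> complex mat \<Rightarrow> complex mat" where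
  "cf_reorder n m Nt X =
     (let ord = F_points m Nt @ C_points m Nt in
      block_mat n (Nt + 1) (Nt + 1) (\<lambda>i j. block_at n X (ord ! i) (ord ! j)))"

definition cf_partition ::
    "nat \<Rightarrow> nat \<Rightarrow> nat \<Rightarrow> complex mat \<Rightarrow> complex mat \<times> complex mat \<times> complex mat \<times> complex mat" where
  "cf_partition n m Nt X =
     (let s = length (F_points m Nt) * n in split_block (cf_reorder n m Nt X) s s)"

end

theory Submission
  imports Defs "HOL-Analysis.Convex"
begin

text \<open>
  Writing \<open>\<Phi> = U diag(\<phi>) U\<inverse>\<close> and \<open>\<Psi> = U diag(\<mu>) U\<inverse>\<close>, every
  block of every operator in the iteration is \<open>U diag(f) U\<inverse>\<close> for a coefficient vector \<open>f\<close>
  that depends on the block only. Block matrices of this kind multiply, add and invert mode by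
  mode (\<open>modal_mult\<close>, \<open>modal_minus\<close>, \<open>mat_inv_local_coarse_op\<close>), so the whole analysis reduces
  to the scalar problem of a single eigenpair \<open>(\<mu>, \<phi>)\<close>.

  For a single mode, a vector in the range of ideal interpolation has zero residual at the F-points
  and residual \<open>v\<^sub>i - \<phi>\<^sup>m v\<^bsub>i-1\<^esub>\<close> at the C-points (\<open>fine_residual_of_interpolant\<close>). The \<open>p\<close>-th
  local coarse solve weighs the residual at C-point \<open>i\<close> by \<open>\<mu>\<^bsup>p-i\<^esup>\<close>. Collecting the terms that
  contain \<open>v\<^sub>q\<close> (\<open>local_solve_defect\<close>) leaves a coefficient that depends on the distance
  \<open>d = p - q\<close> alone: \<open>\<mu>\<^bsup>d-1\<^esup> (\<phi>\<^sup>m - \<mu>)\<close> for \<open>0 < d < k\<close>, and \<open>\<mu>\<^bsup>k-1\<^esup> \<phi>\<^sup>m\<close> at \<open>d = k\<close>, where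
  the local grid contains the residual at \<open>q + 1\<close> but not the one at \<open>q\<close>. Thus \<open>error_op_modal\<close>
  gives the complete error propagator.

  The power formula rests on two facts: the columns of \<open>E\<close> at F-points vanish, because the
  propagator starts with an injection to the C-points, and the CF-reordering is a simultaneous
  permutation of rows and columns and therefore multiplicative (\<open>cf_reorder_mult\<close>).

  For the norm bound, \<open>(W W\<^sup>*)\<inverse>\<close> with \<open>W\<close> block diagonal makes the weighted norm of \<open>x\<close> the
  Euclidean norm of its modal coordinates \<open>W\<inverse> x\<close>, in which \<open>E_cc\<close> is an independent lower
  triangular Toeplitz matrix for each mode. Its row sums and column sums of absolute values are
  both bounded by the geometric sum in the claim (\<open>sum_cmod_defect_le\<close>), and the Schur test turns
  this into a bound of the Euclidean operator norm.
\<close>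

section \<open>Block matrices and sums of matrices\<close>

text \<open>Scalar indices of a block matrix are pairs of a block number and a position inside the block;
  this is the change of variables that turns scalar sums into sums over blocks.\<close>

lemma sum_div_mod:
  fixes f :: "nat \<Rightarrow> nat \<Rightarrow> 'a::comm_monoid_add"
  assumes "0 < n"
  shows "(\<Sum>i<r * n. f (i div n) (i mod n)) = (\<Sum>p<r. \<Sum>a<n. f p a)"
proof -
  have "(\<Sum>i<r * n. f (i div n) (i mod n)) =
        (\<Sum>p<r. \<Sum>i=p * n..<p * n + n. f (i div n) (i mod n))"
    by (rule sum.nat_group[symmetric])
  also have "\<dots> = (\<Sum>p<r. \<Sum>a<n. f p a)"
  proof (rule sum.cong[OF refl])
    fix p
    have "(\<Sum>i=p * n..<p * n + n. f (i div n) (i mod n)) =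
          (\<Sum>a<n. f ((a + p * n) div n) ((a + p * n) mod n))"
      using sum.shift_bounds_nat_ivl[of "\<lambda>i. f (i div n) (i mod n)" 0 "p * n" n]
      by (simp add: add.commute lessThan_atLeast0)
    also have "\<dots> = (\<Sum>a<n. f p a)"
      using assms by (intro sum.cong) auto
    finally show "(\<Sum>i=p * n..<p * n + n. f (i div n) (i mod n)) = (\<Sum>a<n. f p a)" .
  qed
  finally show ?thesis .
qed

lemma block_index_less:
  fixes p r a n :: nat
  assumes "p < r" "a < n"
  shows "p * n + a < r * n"
proof -
  have "p * n + a < (p + 1) * n" using assms by simp
  also have "\<dots> \<le> r * n" using assms by (intro mult_le_mono1) simp
  finally show ?thesis .
qed

lemma block_mat_carrier [simp]: "block_mat n r c B \<in> carrier_mat (r * n) (c * n)"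
  by (simp add: block_mat_def)

lemma block_mat_dim [simp]:
  "dim_row (block_mat n r c B) = r * n" "dim_col (block_mat n r c B) = c * n"
  by (simp_all add: block_mat_def)

lemma block_mat_index:
  assumes "i < r * n" "j < c * n"
  shows "block_mat n r c B $$ (i, j) = B (i div n) (j div n) $$ (i mod n, j mod n)"
  using assms by (simp add: block_mat_def)

lemma block_mat_index_block:
  assumes "p < r" "q < c" "a < n" "b < n"
  shows "block_mat n r c B $$ (p * n + a, q * n + b) = B p q $$ (a, b)"
  using assms by (simp add: block_mat_def block_index_less)

lemma block_mat_cong:
  assumes "\<And>i j. i < r \<Longrightarrow> j < c \<Longrightarrow> B i j = C i j"
  shows "block_mat n r c B = block_mat n r c C"
  using assms by (intro eq_matI) (auto simp: block_mat_index less_mult_imp_div_less)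

text \<open>A right inverse of a square matrix is the inverse, so that the Gauss-Jordan procedure behind
  \<^const>\<open>mat_inverse\<close> cannot fail and can only return it.\<close>

lemma mat_inv_eqI:
  assumes X: "X \<in> carrier_mat N N" and Y: "Y \<in> carrier_mat N N" and XY: "X * Y = 1\<^sub>m N"
  shows "mat_inv X = Y"
proof (cases "mat_inverse X")
  case None
  have "Y * X = 1\<^sub>m N" by (rule mat_mult_left_right_inverse[OF X Y XY])
  then have "X \<in> Units (ring_mat TYPE(complex) N undefined)"
    using X Y XY unfolding Units_def by (auto simp: ring_mat_def)
  then show ?thesis using mat_inverse(1)[OF X None, of undefined] by blast
next
  case (Some Z)
  have Z: "Z \<in> carrier_mat N N" "Z * X = 1\<^sub>m N"
    using mat_inverse(2)[OF X Some] by auto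
  have "Z = Z * (X * Y)" using XY Z by simp
  also have "\<dots> = Z * X * Y" using X Y Z(1) by simp
  also have "\<dots> = Y" using Y Z by simp
  finally show ?thesis using Some by simp
qed

lemma finsum_mat_index:
  assumes "finite S" "\<And>p. p \<in> S \<Longrightarrow> X p \<in> carrier_mat r c"
  shows "finsum_mat r c X S \<in> carrier_mat r c \<and>
    (\<forall>i<r. \<forall>j<c. finsum_mat r c X S $$ (i, j) = (\<Sum>p\<in>S. X p $$ (i, j)))"
proof -
  interpret comm_monoid "monoid_mat TYPE(complex) r c" by (rule comm_monoid_mat)
  show ?thesis using assms
  proof (induction S rule: finite_induct)
    case empty
    then show ?case by (simp only: finsum_mat_def finprod_empty) (simp add: monoid_mat_def)
  next
    case (insert p S)
    have "finsum_mat r c X (insert p S) = X p + finsum_mat r c X S"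
      using insert unfolding finsum_mat_def
      by (subst finprod_insert) (auto simp: monoid_mat_def)
    then show ?case using insert by auto
  qed
qed

lemma eigenvector_unique:
  assumes "eigenvector A v x" "eigenvector A v (y :: complex)"
  shows "x = y"
proof -
  from assms have v: "v \<in> carrier_vec (dim_row A)" "v \<noteq> 0\<^sub>v (dim_row A)"
    and "x \<cdot>\<^sub>v v = y \<cdot>\<^sub>v v" by (auto simp: eigenvector_def)
  then have eq: "x * v $ i = y * v $ i" if "i < dim_vec v" for i
    using that by (metis index_smult_vec(1))
  obtain i where "i < dim_vec v" "v $ i \<noteq> 0" using v by (auto simp: vec_eq_iff)
  then show ?thesis using eq by auto
qed

section \<open>Block matrices that a common eigenbasis diagonalizes\<close>

text \<open>The columns of \<open>U\<close> are the shared eigenvectors, and \<open>V\<close> is its inverse.\<close>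

locale eigenbasis =
  fixes n :: nat and U V :: "complex mat"
  assumes n_pos: "0 < n"
    and U: "U \<in> carrier_mat n n" and V: "V \<in> carrier_mat n n"
    and UV: "U * V = 1\<^sub>m n" and VU: "V * U = 1\<^sub>m n"
begin

lemma UV_sum:
  assumes "a < n" "b < n"
  shows "(\<Sum>e<n. U $$ (a, e) * V $$ (e, b)) = (if a = b then 1 else 0)"
proof -
  have "(U * V) $$ (a, b) = (\<Sum>e<n. U $$ (a, e) * V $$ (e, b))"
    using assms U V by (simp add: scalar_prod_def lessThan_atLeast0)
  then show ?thesis using assms by (simp add: UV)
qed

lemma VU_sum:
  assumes "a < n" "b < n"
  shows "(\<Sum>e<n. V $$ (a, e) * U $$ (e, b)) = (if a = b then 1 else 0)"
proof -
  have "(V * U) $$ (a, b) = (\<Sum>e<n. V $$ (a, e) * U $$ (e, b))"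
    using assms U V by (simp add: scalar_prod_def lessThan_atLeast0)
  then show ?thesis using assms by (simp add: VU)
qed

text \<open>The matrix \<open>U diag(f) V\<close>, spelled out by entries so that sums over the modes can be
  interchanged with sums over blocks.\<close>

definition spectral :: "(nat \<Rightarrow> complex) \<Rightarrow> complex mat" where
  "spectral f = Matrix.mat n n (\<lambda>(a, b). \<Sum>e<n. U $$ (a, e) * f e * V $$ (e, b))"

lemma spectral_dim [simp]: "dim_row (spectral f) = n" "dim_col (spectral f) = n"
  by (simp_all add: spectral_def)

lemma spectral_index:
  assumes "a < n" "b < n"
  shows "spectral f $$ (a, b) = (\<Sum>e<n. U $$ (a, e) * f e * V $$ (e, b))"
  using assms by (simp add: spectral_def)

lemma spectral_cong: "(\<And>e. e < n \<Longrightarrow> f e = g e) \<Longrightarrow> spectral f = spectral g"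
  by (intro eq_matI) (auto simp: spectral_index)

lemma spectral_one: "spectral (\<lambda>e. 1) = 1\<^sub>m n"
  by (intro eq_matI) (auto simp: spectral_index UV_sum)

lemma spectral_zero: "spectral (\<lambda>e. 0) = 0\<^sub>m n n"
  by (intro eq_matI) (auto simp: spectral_index)

lemma spectral_uminus: "spectral (\<lambda>e. - f e) = - spectral f"
  by (intro eq_matI) (auto simp: spectral_index sum_negf)

lemma spectral_mult_U:
  assumes "a < n" "e < n"
  shows "(\<Sum>b<n. spectral f $$ (a, b) * U $$ (b, e)) = U $$ (a, e) * f e"
proof -
  have "(\<Sum>b<n. spectral f $$ (a, b) * U $$ (b, e)) =
        (\<Sum>b<n. \<Sum>e'<n. U $$ (a, e') * f e' * V $$ (e', b) * U $$ (b, e))"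
    using assms by (simp add: spectral_index sum_distrib_right)
  also have "\<dots> = (\<Sum>e'<n. \<Sum>b<n. U $$ (a, e') * f e' * V $$ (e', b) * U $$ (b, e))"
    by (rule sum.swap)
  also have "\<dots> = (\<Sum>e'<n. U $$ (a, e') * f e' * (\<Sum>b<n. V $$ (e', b) * U $$ (b, e)))"
    by (simp add: sum_distrib_left mult.assoc)
  also have "\<dots> = (\<Sum>e'<n. U $$ (a, e') * f e' * (if e' = e then 1 else 0))"
    using assms by (intro sum.cong) (auto simp: VU_sum)
  also have "\<dots> = U $$ (a, e) * f e"
    using assms by (simp add: if_distrib[of "\<lambda>x. _ * x"] cong: if_cong)
  finally show ?thesis .
qed

lemma spectral_mult_index:
  assumes "a < n" "b < n"
  shows "(\<Sum>c<n. spectral f $$ (a, c) * spectral g $$ (c, b)) = spectral (\<lambda>e. f e * g e) $$ (a, b)"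
proof -
  have "(\<Sum>c<n. spectral f $$ (a, c) * spectral g $$ (c, b)) =
        (\<Sum>c<n. \<Sum>e<n. spectral f $$ (a, c) * (U $$ (c, e) * g e * V $$ (e, b)))"
    using assms by (simp add: spectral_index[of _ b] sum_distrib_left)
  also have "\<dots> = (\<Sum>e<n. \<Sum>c<n. spectral f $$ (a, c) * (U $$ (c, e) * g e * V $$ (e, b)))"
    by (rule sum.swap)
  also have "\<dots> = (\<Sum>e<n. (\<Sum>c<n. spectral f $$ (a, c) * U $$ (c, e)) * (g e * V $$ (e, b)))"
    by (simp add: sum_distrib_right mult.assoc)
  also have "\<dots> = (\<Sum>e<n. U $$ (a, e) * (f e * g e) * V $$ (e, b))"
    using assms by (intro sum.cong) (auto simp: spectral_mult_U)
  finally show ?thesis using assms by (simp add: spectral_index)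
qed

lemma spectral_mult: "spectral f * spectral g = spectral (\<lambda>e. f e * g e)"
  by (intro eq_matI)
    (auto simp: scalar_prod_def spectral_mult_index[symmetric] lessThan_atLeast0)

lemma spectral_pow: "spectral f ^\<^sub>m j = spectral (\<lambda>e. f e ^ j)"
  by (induction j) (simp_all add: spectral_one spectral_mult mult.commute)

lemma spectral_sum_index:
  assumes "a < n" "b < n"
  shows "spectral (\<lambda>e. \<Sum>x\<in>S. f x e) $$ (a, b) = (\<Sum>x\<in>S. spectral (f x) $$ (a, b))"
  using assms sum.swap[of "\<lambda>x e. U $$ (a, e) * f x e * V $$ (e, b)" "{..<n}" S]
  by (simp add: spectral_index sum_distrib_left sum_distrib_right)

lemma eigenvector_spectral_col:
  assumes e: "e < n"
  shows "eigenvector (spectral f) (col U e) (f e)"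
proof -
  have "col U e \<noteq> 0\<^sub>v n"
  proof
    assume "col U e = 0\<^sub>v n"
    then have "U $$ (b, e) = 0" if "b < n" for b
      using that e U index_col[of b U e] by auto
    then have "(\<Sum>b<n. V $$ (e, b) * U $$ (b, e)) = 0" by simp
    then show False using VU_sum[OF e e] by simp
  qed
  moreover have "spectral f *\<^sub>v col U e = f e \<cdot>\<^sub>v col U e"
  proof (intro eq_vecI)
    fix a assume "a < dim_vec (f e \<cdot>\<^sub>v col U e)"
    then have a: "a < n" using U by simp
    have "(spectral f *\<^sub>v col U e) $ a = (\<Sum>b<n. spectral f $$ (a, b) * U $$ (b, e))"
      using a e U by (simp add: scalar_prod_def lessThan_atLeast0)
    then show "(spectral f *\<^sub>v col U e) $ a = (f e \<cdot>\<^sub>v col U e) $ a"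
      using a e U by (simp add: spectral_mult_U)
  qed (use U in simp)
  ultimately show ?thesis using e U by (auto simp: eigenvector_def)
qed

text \<open>Every column of \<open>U\<close> is an eigenvector of both matrices, and an eigenvector determines its
  eigenvalue. The set of shared pairs is therefore finite and indexed by the modes.\<close>

lemma shared_eigenpairs_spectral:
  "shared_eigenpairs (spectral f) (spectral g) U = (\<lambda>e. (g e, f e)) ` {..<n}"
proof -
  have "eigenvector (spectral f) (col U e) x \<longleftrightarrow> x = f e" if "e < n" for e f x
    using that eigenvector_spectral_col eigenvector_unique by blast
  then show ?thesis using U by (auto simp: shared_eigenpairs_def)
qed

lemma spectral_in_spectrum: "e < n \<Longrightarrow> f e \<in> spectrum (spectral f)"
  using eigenvector_spectral_col by (auto simp: spectrum_def eigenvalue_def)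

text \<open>In \<open>g e i j\<close> the mode comes first: for fixed \<open>e\<close>, \<open>g e\<close> is the scalar \<open>r \<times> c\<close> matrix by
  which the operator acts on the coordinates of mode \<open>e\<close>.\<close>

definition modal :: "nat \<Rightarrow> nat \<Rightarrow> (nat \<Rightarrow> nat \<Rightarrow> nat \<Rightarrow> complex) \<Rightarrow> complex mat" where
  "modal r c g = block_mat n r c (\<lambda>i j. spectral (\<lambda>e. g e i j))"

lemma modal_carrier [simp]: "modal r c g \<in> carrier_mat (r * n) (c * n)"
  by (simp add: modal_def)

lemma modal_cong:
  assumes "\<And>e i j. e < n \<Longrightarrow> i < r \<Longrightarrow> j < c \<Longrightarrow> g e i j = h e i j"
  shows "modal r c g = modal r c h"
  unfolding modal_def using assms by (intro block_mat_cong spectral_cong)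

lemma block_mat_eq_modal:
  assumes "\<And>i j. i < r \<Longrightarrow> j < c \<Longrightarrow> B i j = spectral (\<lambda>e. g e i j)"
  shows "block_mat n r c B = modal r c g"
  unfolding modal_def using assms by (rule block_mat_cong)

text \<open>The factors \<open>V U\<close> between adjacent blocks cancel, so distinct modes do not interact and the
  product is the scalar matrix product in each mode.\<close>

lemma modal_mult:
  "modal r c g * modal c d h = modal r d (\<lambda>e i j. \<Sum>l<c. g e i l * h e l j)"
proof (intro eq_matI)
  fix i j
  assume "i < dim_row (modal r d (\<lambda>e i j. \<Sum>l<c. g e i l * h e l j))"
    and "j < dim_col (modal r d (\<lambda>e i j. \<Sum>l<c. g e i l * h e l j))"
  then have ij: "i < r * n" "j < d * n" by (simp_all add: modal_def)
  have md: "i mod n < n" "j mod n < n" using n_pos by auto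
  let ?G = "\<lambda>l. spectral (\<lambda>e. g e (i div n) l)" and ?H = "\<lambda>l. spectral (\<lambda>e. h e l (j div n))"
  have "(modal r c g * modal c d h) $$ (i, j) =
        (\<Sum>t<c * n. ?G (t div n) $$ (i mod n, t mod n) * ?H (t div n) $$ (t mod n, j mod n))"
    using ij by (simp add: modal_def scalar_prod_def lessThan_atLeast0 block_mat_index)
  also have "\<dots> = (\<Sum>l<c. \<Sum>b<n. ?G l $$ (i mod n, b) * ?H l $$ (b, j mod n))"
    by (rule sum_div_mod[OF n_pos])
  also have "\<dots> = (\<Sum>l<c. spectral (\<lambda>e. g e (i div n) l * h e l (j div n)) $$ (i mod n, j mod n))"
    using md by (simp add: spectral_mult_index)
  also have "\<dots> = modal r d (\<lambda>e i j. \<Sum>l<c. g e i l * h e l j) $$ (i, j)"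
    using ij md by (simp add: modal_def block_mat_index spectral_sum_index)
  finally show "(modal r c g * modal c d h) $$ (i, j) =
        modal r d (\<lambda>e i j. \<Sum>l<c. g e i l * h e l j) $$ (i, j)" .
qed (simp_all add: modal_def)

lemma modal_one: "modal r r (\<lambda>e i j. if i = j then 1 else 0) = 1\<^sub>m (r * n)"
proof (intro eq_matI)
  fix i j assume "i < dim_row (1\<^sub>m (r * n) :: complex mat)" "j < dim_col (1\<^sub>m (r * n) :: complex mat)"
  then have ij: "i < r * n" "j < r * n" by simp_all
  have md: "i mod n < n" "j mod n < n" using n_pos by auto
  have "i = j \<longleftrightarrow> i div n = j div n \<and> i mod n = j mod n" by (metis div_mult_mod_eq)
  then show "modal r r (\<lambda>e i j. if i = j then 1 else 0) $$ (i, j) = 1\<^sub>m (r * n) $$ (i, j)"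
    using ij md by (auto simp: modal_def block_mat_index spectral_one spectral_zero)
qed (simp_all add: modal_def)

lemma modal_minus: "modal r c g - modal r c h = modal r c (\<lambda>e i j. g e i j - h e i j)"
  using n_pos by (intro eq_matI)
    (auto simp: modal_def block_mat_index spectral_index right_diff_distrib left_diff_distrib
      sum_subtractf)

lemma finsum_modal:
  assumes "finite S"
  shows "finsum_mat (r * n) (c * n) (\<lambda>p. modal r c (g p)) S = modal r c (\<lambda>e i j. \<Sum>p\<in>S. g p e i j)"
  using finsum_mat_index[OF assms modal_carrier, of r c g] n_pos
  by (intro eq_matI) (auto simp: modal_def block_mat_index spectral_sum_index)

end

section \<open>The error propagator of a single mode\<close>

text \<open>The coefficient with which a single mode transports an error at C-point \<open>q\<close> to C-point
  \<open>p = q + d\<close> in one iteration; \<open>\<Lambda>\<close> is the \<open>m\<close>-th power of the fine eigenvalue. The value \<open>0\<close>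
  at \<open>d = 0\<close> also covers \<open>p < q\<close>, where the truncated difference \<open>p - q\<close> is \<open>0\<close>.\<close>

definition defect :: "nat \<Rightarrow> complex \<Rightarrow> complex \<Rightarrow> nat \<Rightarrow> complex" where
  "defect k \<Lambda> \<mu> d = (if d = 0 then 0 else if d < k then \<mu> ^ (d - 1) * (\<Lambda> - \<mu>)
     else if d = k then \<mu> ^ (k - 1) * \<Lambda> else 0)"

text \<open>A row of a bidiagonal time-stepping matrix applied to a vector; the case distinction is the
  missing predecessor of the initial time point.\<close>

lemma bidiagonal_sum:
  fixes f :: "nat \<Rightarrow> complex"
  assumes "i < r"
  shows "(\<Sum>l<r. (if i = l then 1 else if i = l + 1 then - c else 0) * f l) =
         f i - (if 0 < i then c * f (i - 1) else 0)"
proof -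
  have "(\<Sum>l<r. (if i = l then 1 else if i = l + 1 then - c else 0) * f l) =
        (\<Sum>l<r. if l = i then f i else 0) - (\<Sum>l<r. if l = i - 1 then (if 0 < i then c * f (i - 1) else 0) else 0)"
    by (subst sum_subtractf[symmetric], intro sum.cong) auto
  also have "\<dots> = f i - (if 0 < i then c * f (i - 1) else 0)"
    using assms by (subst (1 2) sum.delta) auto
  finally show ?thesis .
qed

lemma sum_shifted_delta:
  fixes f :: "nat \<Rightarrow> complex"
  shows "(\<Sum>l<r. f l * (if q = s + l then c else 0)) = (if s \<le> q \<and> q < s + r then f (q - s) * c else 0)"
proof -
  have "(\<Sum>l<r. f l * (if q = s + l then c else 0)) =
        (\<Sum>l<r. if l = q - s then (if s \<le> q then f (q - s) * c else 0) else 0)"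
    by (intro sum.cong) auto
  then show ?thesis by auto
qed

text \<open>The sum is the value at the last point of the \<open>p\<close>-th local coarse grid after solving there for
  the residual of an error that is \<open>1\<close> at C-point \<open>q\<close>. Such an error enters the residual at \<open>q\<close>
  with weight \<open>1\<close> and at \<open>q + 1\<close> with weight \<open>-\<Lambda>\<close>. If both points lie in the local grid, the two
  contributions combine to the factor \<open>\<Lambda> - \<mu>\<close>; at \<open>p - q = k\<close> only \<open>q + 1\<close> lies in it, which
  leaves the factor \<open>\<Lambda>\<close>.\<close>

lemma local_solve_defect:
  assumes "1 \<le> k"
  shows "(if p = q then 1 else 0) -
    (\<Sum>l<local_size k p. \<mu> ^ (local_size k p - 1 - l) *
       ((if q = local_start k p + l then 1 else 0) - (if q + 1 = local_start k p + l then \<Lambda> else 0)))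
    = defect k \<Lambda> \<mu> (p - q)"
proof -
  let ?r = "local_size k p" and ?s = "local_start k p"
  have rs: "?s + ?r = p + 1" "1 \<le> ?r"
    using assms by (auto simp: local_size_def local_start_def)
  have 1: "(\<Sum>l<?r. \<mu> ^ (?r - 1 - l) * (if q = ?s + l then 1 else 0)) =
        (if ?s \<le> q \<and> q \<le> p then \<mu> ^ (p - q) else 0)"
    using rs by (subst sum_shifted_delta) (auto intro!: arg_cong[of _ _ "\<lambda>d. \<mu> ^ d"])
  have 2: "(\<Sum>l<?r. \<mu> ^ (?r - 1 - l) * (if q + 1 = ?s + l then \<Lambda> else 0)) =
        (if ?s \<le> q + 1 \<and> q < p then \<mu> ^ (p - q - 1) * \<Lambda> else 0)"
    using rs by (subst sum_shifted_delta) (auto intro!: arg_cong[of _ _ "\<lambda>d. \<mu> ^ d"])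
  have split: "(\<Sum>l<?r. \<mu> ^ (?r - 1 - l) *
       ((if q = ?s + l then 1 else 0) - (if q + 1 = ?s + l then \<Lambda> else 0))) =
       (if ?s \<le> q \<and> q \<le> p then \<mu> ^ (p - q) else 0) -
       (if ?s \<le> q + 1 \<and> q < p then \<mu> ^ (p - q - 1) * \<Lambda> else 0)"
    unfolding right_diff_distrib sum_subtractf 1 2 ..
  consider "p < q" | "p = q" | "q < p" "p - q < k" | "p - q = k" | "k < p - q" by linarith
  then show ?thesis
  proof cases
    case 3
    then have "\<mu> ^ (p - q) = \<mu> ^ (p - q - 1) * \<mu>"
      by (metis Suc_diff_1 power_Suc2 zero_less_diff)
    then show ?thesis using 3 unfolding split
      by (auto simp: defect_def local_start_def algebra_simps)
  qed (unfold split, use assms in \<open>auto simp: defect_def local_start_def\<close>)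
qed

text \<open>Ideal interpolation runs the fine integrator exactly through the \<open>m - 1\<close> F-points after a
  C-point, hence the step into C-point \<open>c\<close> compares its value with \<open>m\<close> fine steps from the
  preceding C-point.\<close>

lemma fine_residual_of_interpolant:
  assumes N: "Nt + 1 = m * (NT + 1)" and m: "0 < m" and c: "c \<le> NT"
  shows "(\<Sum>t<Nt + 1. (if c * m = t then 1 else if c * m = t + 1 then - x else 0) *
      (if j = t div m * m then x ^ (t mod m) else 0)) =
    (if j = c * m then 1 else 0) - (if j + m = c * m then x ^ m else (0::complex))"
proof -
  have "c * m < Nt + 1"
    using le_less_trans[OF mult_le_mono1[OF c, of m], of "Nt + 1"] m unfolding N by simp
  then have "(\<Sum>t<Nt + 1. (if c * m = t then 1 else if c * m = t + 1 then - x else 0) *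
      (if j = t div m * m then x ^ (t mod m) else 0)) =
      (if j = c * m then 1 else 0) -
      (if 0 < c * m then x * (if j = (c * m - 1) div m * m then x ^ ((c * m - 1) mod m) else 0) else 0)"
    using m by (subst bidiagonal_sum) auto
  also have "(if 0 < c * m then x * (if j = (c * m - 1) div m * m then x ^ ((c * m - 1) mod m) else 0) else 0)
      = (if j + m = c * m then x ^ m else 0)"
  proof (cases c)
    case (Suc d)
    have e: "c * m - 1 = (m - 1) + d * m" using Suc m by simp
    have "(c * m - 1) div m = d"
      unfolding e by (subst div_mult_self1) (use m in simp_all)
    moreover have "(c * m - 1) mod m = m - 1"
      unfolding e by (subst mod_mult_self1) (use m in simp)
    ultimately
    show ?thesis using Suc m by (simp add: power_eq_if)
  qed (use m in simp)
  finally show ?thesis .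
qed

context eigenbasis
begin

lemma fine_op_modal:
  "fine_op n Nt (spectral \<phi>) = modal (Nt + 1) (Nt + 1)
     (\<lambda>e i j. if i = j then 1 else if i = j + 1 then - \<phi> e else 0)"
  unfolding fine_op_def
  by (rule block_mat_eq_modal) (auto simp: spectral_one spectral_zero spectral_uminus)

lemma local_coarse_op_modal:
  "local_coarse_op n k p (spectral \<mu>) = modal (local_size k p) (local_size k p)
     (\<lambda>e i j. if i = j then 1 else if i = j + 1 then - \<mu> e else 0)"
  unfolding local_coarse_op_def
  by (rule block_mat_eq_modal) (auto simp: spectral_one spectral_zero spectral_uminus)

text \<open>Solving the coarse recurrence \<open>v\<^sub>i = \<mu> v\<^bsub>i-1\<^esub> + r\<^sub>i\<close> by forward substitution weighs \<open>r\<^sub>j\<close> by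
  \<open>\<mu>\<^bsup>i-j\<^esup>\<close>.\<close>

lemma mat_inv_local_coarse_op:
  "mat_inv (local_coarse_op n k p (spectral \<mu>)) = modal (local_size k p) (local_size k p)
     (\<lambda>e i j. if j \<le> i then \<mu> e ^ (i - j) else 0)"
proof (rule mat_inv_eqI)
  let ?r = "local_size k p"
  show "local_coarse_op n k p (spectral \<mu>) \<in> carrier_mat (?r * n) (?r * n)"
    by (simp add: local_coarse_op_modal)
  have "local_coarse_op n k p (spectral \<mu>) *
      modal ?r ?r (\<lambda>e i j. if j \<le> i then \<mu> e ^ (i - j) else 0) =
      modal ?r ?r (\<lambda>e i j. if i = j then 1 else 0)"
    unfolding local_coarse_op_modal modal_mult
  proof (rule modal_cong)
    fix e i j assume "i < ?r" "j < ?r"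
    moreover have "\<mu> e ^ (i - j) = \<mu> e * \<mu> e ^ (i - 1 - j)" if "j < i"
      using that by (simp flip: power_Suc add: Suc_diff_Suc)
    ultimately show "(\<Sum>l<?r. (if i = l then 1 else if i = l + 1 then - \<mu> e else 0) *
        (if j \<le> l then \<mu> e ^ (l - j) else 0)) = (if i = j then 1 else 0)"
      by (subst bidiagonal_sum) auto
  qed
  then show "local_coarse_op n k p (spectral \<mu>) *
      modal ?r ?r (\<lambda>e i j. if j \<le> i then \<mu> e ^ (i - j) else 0) = 1\<^sub>m (?r * n)"
    by (simp only: modal_one)
qed simp

lemma interp_restrict_modal:
  assumes N: "Nt + 1 = m * (NT + 1)" and m: "0 < m"
  shows "ideal_interp n m Nt NT (spectral \<phi>) * restrict_C n m Nt NT =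
    modal (Nt + 1) (Nt + 1) (\<lambda>e i j. if j = i div m * m then \<phi> e ^ (i mod m) else 0)"
proof -
  have "ideal_interp n m Nt NT (spectral \<phi>) = modal (Nt + 1) (NT + 1)
      (\<lambda>e i p. if i div m = p then \<phi> e ^ (i mod m) else 0)"
    unfolding ideal_interp_def
    by (rule block_mat_eq_modal) (auto simp: spectral_pow spectral_zero)
  moreover have "restrict_C n m Nt NT = modal (NT + 1) (Nt + 1)
      (\<lambda>e p j. if j = p * m then 1 else 0)"
    unfolding restrict_C_def
    by (rule block_mat_eq_modal) (auto simp: spectral_one spectral_zero)
  moreover have "(\<Sum>p<NT + 1. (if i div m = p then \<phi> e ^ (i mod m) else 0) * (if j = p * m then 1 else 0))
      = (if j = i div m * m then \<phi> e ^ (i mod m) else 0)" if "i < Nt + 1" for e i j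
  proof -
    have p: "i div m < NT + 1"
      using that N m by (simp add: less_mult_imp_div_less mult.commute)
    have "(\<Sum>p<NT + 1. (if i div m = p then \<phi> e ^ (i mod m) else 0) * (if j = p * m then 1 else 0)) =
       (\<Sum>p<NT + 1. if p = i div m then (if j = i div m * m then \<phi> e ^ (i mod m) else 0) else 0)"
      by (intro sum.cong) auto
    then show ?thesis using p by simp
  qed
  ultimately show ?thesis
    by (simp only: modal_mult) (rule modal_cong, simp)
qed

text \<open>Selective interpolation reads off only the last row of the inverse local coarse operator, and
  writes only to the \<open>p\<close>-th coarse interval; the latter makes the corrections for different \<open>p\<close>
  act on disjoint block rows, so that each row of their sum has a single contribution.\<close>

lemma local_correction_modal:
  assumes N: "Nt + 1 = m * (NT + 1)" and m: "0 < m" and k: "1 \<le> k" and p: "p \<le> NT"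
  shows "selective_interp n m Nt k p (spectral \<phi>) * mat_inv (local_coarse_op n k p (spectral \<mu>))
      * local_restrict n m Nt k p * fine_op n Nt (spectral \<phi>) =
    modal (Nt + 1) (Nt + 1) (\<lambda>e i j. if i div m = p then \<phi> e ^ (i mod m) *
      (\<Sum>l<local_size k p. \<mu> e ^ (local_size k p - 1 - l) *
        (if (local_start k p + l) * m = j then 1
         else if (local_start k p + l) * m = j + 1 then - \<phi> e else 0)) else 0)"
proof -
  let ?r = "local_size k p" and ?s = "local_start k p" and ?N = "Nt + 1"
  let ?a = "\<lambda>e i j. if i = j then 1 else if i = j + 1 then - \<phi> e else 0"
  have r: "0 < ?r" and rs: "?s + ?r = p + 1" using k by (auto simp: local_size_def local_start_def)
  have S: "selective_interp n m Nt k p (spectral \<phi>) = modal ?N ?r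
      (\<lambda>e i j. if j + 1 = ?r \<and> i div m = p then \<phi> e ^ (i mod m) else 0)"
    unfolding selective_interp_def
  proof (rule block_mat_eq_modal)
    fix i j
    have "p * m \<le> i \<and> i < p * m + m \<longleftrightarrow> i div m = p"
      using m by (metis div_nat_eqI dividend_less_times_div mult.commute mult_Suc add.commute
          div_times_less_eq_dividend)
    moreover have "i - p * m = i mod m" if "i div m = p"
      using that by (metis minus_div_mult_eq_mod)
    ultimately show "(if j + 1 = ?r \<and> p * m \<le> i \<and> i < p * m + m
        then spectral \<phi> ^\<^sub>m (i - p * m) else 0\<^sub>m n n) =
      spectral (\<lambda>e. if j + 1 = ?r \<and> i div m = p then \<phi> e ^ (i mod m) else 0)"
      by (cases "j + 1 = ?r \<and> i div m = p") (auto simp: spectral_pow spectral_zero)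
  qed
  have R: "local_restrict n m Nt k p = modal ?r ?N (\<lambda>e l j. if j = (?s + l) * m then 1 else 0)"
    unfolding local_restrict_def
    by (rule block_mat_eq_modal) (auto simp: spectral_one spectral_zero)
  have "selective_interp n m Nt k p (spectral \<phi>) * mat_inv (local_coarse_op n k p (spectral \<mu>)) =
      modal ?N ?r (\<lambda>e i l. if i div m = p then \<phi> e ^ (i mod m) * \<mu> e ^ (?r - 1 - l) else 0)"
    unfolding S mat_inv_local_coarse_op modal_mult
  proof (rule modal_cong)
    fix e i l assume l: "l < ?r"
    have "(\<Sum>h<?r. (if h + 1 = ?r \<and> i div m = p then \<phi> e ^ (i mod m) else 0) *
          (if l \<le> h then \<mu> e ^ (h - l) else 0)) =
        (\<Sum>h<?r. if h = ?r - 1 then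
          (if i div m = p then \<phi> e ^ (i mod m) * \<mu> e ^ (?r - 1 - l) else 0) else 0)"
      using l by (intro sum.cong) auto
    then show "(\<Sum>h<?r. (if h + 1 = ?r \<and> i div m = p then \<phi> e ^ (i mod m) else 0) *
          (if l \<le> h then \<mu> e ^ (h - l) else 0)) =
        (if i div m = p then \<phi> e ^ (i mod m) * \<mu> e ^ (?r - 1 - l) else 0)"
      using r by simp
  qed
  moreover have "local_restrict n m Nt k p * fine_op n Nt (spectral \<phi>) =
      modal ?r ?N (\<lambda>e l j. ?a e ((?s + l) * m) j)"
    unfolding R fine_op_modal modal_mult
  proof (rule modal_cong)
    fix e l j assume "l < ?r"
    then have "?s + l \<le> NT" using rs p by linarith
    then have "(?s + l) * m < ?N"
      using le_less_trans[OF mult_le_mono1[of "?s + l" NT m], of "Nt + 1"] m unfolding N by simp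
    moreover have "(\<Sum>h<?N. (if h = (?s + l) * m then 1 else 0) * ?a e h j) =
        (\<Sum>h<?N. if h = (?s + l) * m then ?a e ((?s + l) * m) j else 0)"
      by (intro sum.cong) auto
    ultimately show "(\<Sum>h<?N. (if h = (?s + l) * m then 1 else 0) * ?a e h j) = ?a e ((?s + l) * m) j"
      by simp
  qed
  moreover have "selective_interp n m Nt k p (spectral \<phi>) * mat_inv (local_coarse_op n k p (spectral \<mu>))
      * local_restrict n m Nt k p * fine_op n Nt (spectral \<phi>) =
     (selective_interp n m Nt k p (spectral \<phi>) * mat_inv (local_coarse_op n k p (spectral \<mu>)))
      * (local_restrict n m Nt k p * fine_op n Nt (spectral \<phi>))"
    by (rule assoc_mult_mat[of _ "?N * n" "?r * n" _ "?N * n" _ "?N * n"])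
      (simp_all only: S R mat_inv_local_coarse_op fine_op_modal modal_mult modal_carrier)
  ultimately show ?thesis
    by (simp only: modal_mult) (rule modal_cong, simp add: sum_distrib_left mult.assoc)
qed

text \<open>Row \<open>i\<close> sees only the correction of its own coarse interval \<open>i div m\<close>, and interpolation
  carries the C-point value forward by \<open>i mod m\<close> fine steps. Columns at F-points vanish because of
  the initial injection.\<close>

lemma error_op_modal:
  assumes N: "Nt + 1 = m * (NT + 1)" and m: "0 < m" and k: "1 \<le> k"
  shows "error_op n m Nt NT k (spectral \<phi>) (spectral \<mu>) =
    modal (Nt + 1) (Nt + 1) (\<lambda>e i j. if m dvd j
      then \<phi> e ^ (i mod m) * defect k (\<phi> e ^ m) (\<mu> e) (i div m - j div m) else 0)"
proof -
  let ?N = "Nt + 1"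
  let ?a = "\<lambda>e i j. if i = j then 1 else if i = j + 1 then - \<phi> e else 0"
  let ?pr = "\<lambda>e i j. if j = i div m * m then \<phi> e ^ (i mod m) else 0"
  define w where "w p e j = (\<Sum>l<local_size k p. \<mu> e ^ (local_size k p - 1 - l) *
      ?a e ((local_start k p + l) * m) j)" for p e j
  have corr: "selective_interp n m Nt k p (spectral \<phi>) *
        mat_inv (local_coarse_op n k p (spectral \<mu>)) * local_restrict n m Nt k p *
        fine_op n Nt (spectral \<phi>) =
      modal ?N ?N (\<lambda>e i j. if i div m = p then \<phi> e ^ (i mod m) * w p e j else 0)"
    if "p \<le> NT" for p
    unfolding w_def by (rule local_correction_modal[OF N m k that])
  have "finsum_mat (?N * n) (?N * n) (\<lambda>p. selective_interp n m Nt k p (spectral \<phi>) *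
        mat_inv (local_coarse_op n k p (spectral \<mu>)) * local_restrict n m Nt k p *
        fine_op n Nt (spectral \<phi>)) {0..NT} =
      finsum_mat (?N * n) (?N * n) (\<lambda>p. modal ?N ?N
        (\<lambda>e i j. if i div m = p then \<phi> e ^ (i mod m) * w p e j else 0)) {0..NT}"
    unfolding finsum_mat_def
    by (intro comm_monoid.finprod_cong' comm_monoid_mat)
      (auto simp: corr monoid_mat_def modal_carrier[of "Nt + 1" "Nt + 1", simplified])
  also have "\<dots> = modal ?N ?N (\<lambda>e i j. \<phi> e ^ (i mod m) * w (i div m) e j)"
    unfolding finsum_modal[OF finite_atLeastAtMost]
  proof (rule modal_cong)
    fix e i j assume "i < ?N"
    then have "i div m \<le> NT"
      using N m by (metis Suc_eq_plus1 less_Suc_eq_le less_mult_imp_div_less mult.commute)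
    then show "(\<Sum>p\<in>{0..NT}. if i div m = p then \<phi> e ^ (i mod m) * w p e j else 0) =
        \<phi> e ^ (i mod m) * w (i div m) e j"
      by simp
  qed
  finally have "error_op n m Nt NT k (spectral \<phi>) (spectral \<mu>) =
      (modal ?N ?N (\<lambda>e i j. if i = j then 1 else 0) -
       modal ?N ?N (\<lambda>e i j. \<phi> e ^ (i mod m) * w (i div m) e j)) * modal ?N ?N ?pr"
    by (simp only: error_op_def Let_def modal_one interp_restrict_modal[OF N m])
  also have "\<dots> = modal ?N ?N (\<lambda>e i j. \<Sum>t<?N.
      ((if i = t then 1 else 0) - \<phi> e ^ (i mod m) * w (i div m) e t) * ?pr e t j)"
    by (simp only: modal_minus modal_mult)
  also have "\<dots> = modal ?N ?N (\<lambda>e i j. if m dvd j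
      then \<phi> e ^ (i mod m) * defect k (\<phi> e ^ m) (\<mu> e) (i div m - j div m) else 0)"
  proof (rule modal_cong)
    fix e i j assume i: "i < ?N"
    define p where "p = i div m"
    let ?r = "local_size k p" and ?s = "local_start k p"
    have p: "p \<le> NT"
      using i N m unfolding p_def by (metis Suc_eq_plus1 less_Suc_eq_le less_mult_imp_div_less mult.commute)
    have sl: "?s + l \<le> NT" if "l < ?r" for l
      using that p k by (auto simp: local_size_def local_start_def)
    have "(\<Sum>t<?N. ((if i = t then 1 else 0) - \<phi> e ^ (i mod m) * w p e t) * ?pr e t j) =
        (\<Sum>t<?N. if i = t then ?pr e i j else 0) - \<phi> e ^ (i mod m) * (\<Sum>t<?N. w p e t * ?pr e t j)"
      unfolding sum_distrib_left sum_subtractf[symmetric] by (intro sum.cong) (auto simp: algebra_simps)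
    also have "(\<Sum>t<?N. if i = t then ?pr e i j else 0) =
        (if j = p * m then \<phi> e ^ (i mod m) else 0)" using i by (simp add: p_def)
    \<comment> \<open>Applying the fine operator to the interpolant first leaves only residuals at C-points.\<close>
    also have "(\<Sum>t<?N. w p e t * ?pr e t j) =
        (\<Sum>l<?r. \<Sum>t<?N. \<mu> e ^ (?r - 1 - l) * ?a e ((?s + l) * m) t * ?pr e t j)"
      unfolding w_def sum_distrib_right by (rule sum.swap)
    also have "\<dots> = (\<Sum>l<?r. \<mu> e ^ (?r - 1 - l) *
        ((if j = (?s + l) * m then 1 else 0) - (if j + m = (?s + l) * m then \<phi> e ^ m else 0)))"
      using fine_residual_of_interpolant[OF N m sl]
      by (intro sum.cong) (auto simp only: mult.assoc sum_distrib_left[symmetric] lessThan_iff)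
    finally have eq: "(\<Sum>t<?N. ((if i = t then 1 else 0) - \<phi> e ^ (i mod m) * w p e t) * ?pr e t j) =
        (if j = p * m then \<phi> e ^ (i mod m) else 0) - \<phi> e ^ (i mod m) * (\<Sum>l<?r. \<mu> e ^ (?r - 1 - l) *
        ((if j = (?s + l) * m then 1 else 0) - (if j + m = (?s + l) * m then \<phi> e ^ m else 0)))" .
    show "(\<Sum>t<?N. ((if i = t then 1 else 0) - \<phi> e ^ (i mod m) * w (i div m) e t) * ?pr e t j) =
      (if m dvd j then \<phi> e ^ (i mod m) * defect k (\<phi> e ^ m) (\<mu> e) (i div m - j div m) else 0)"
      unfolding p_def[symmetric] eq
    proof (cases "m dvd j")
      case True
      then obtain q where q: "j = q * m" by (metis dvd_div_mult_self)
      have dj: "j = c * m \<longleftrightarrow> q = c" "j + m = c * m \<longleftrightarrow> q + 1 = c" for c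
        using m unfolding q
        by (simp, metis add.commute mult.commute mult_Suc nat_mult_eq_cancel1 Suc_eq_plus1)
      have jm: "j div m = q" using m q by simp
      show "(if j = p * m then \<phi> e ^ (i mod m) else 0) - \<phi> e ^ (i mod m) *
          (\<Sum>l<?r. \<mu> e ^ (?r - 1 - l) * ((if j = (?s + l) * m then 1 else 0) -
            (if j + m = (?s + l) * m then \<phi> e ^ m else 0))) =
        (if m dvd j then \<phi> e ^ (i mod m) * defect k (\<phi> e ^ m) (\<mu> e) (p - j div m) else 0)"
        using True unfolding dj jm local_solve_defect[OF k, of p q "\<mu> e" "\<phi> e ^ m", symmetric]
        by (auto simp: right_diff_distrib[of "\<phi> e ^ (i mod m)"])
    next
      case False
      then have "j \<noteq> c * m" for c by auto
      moreover have "j + m \<noteq> c * m" for c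
        using False dvd_add_left_iff[of m m j] by (metis dvd_refl dvd_triv_right)
      ultimately show "(if j = p * m then \<phi> e ^ (i mod m) else 0) - \<phi> e ^ (i mod m) *
          (\<Sum>l<?r. \<mu> e ^ (?r - 1 - l) * ((if j = (?s + l) * m then 1 else 0) -
            (if j + m = (?s + l) * m then \<phi> e ^ m else 0))) =
        (if m dvd j then \<phi> e ^ (i mod m) * defect k (\<phi> e ^ m) (\<mu> e) (p - j div m) else 0)"
        using False by simp
    qed
  qed
  finally show ?thesis .
qed

end

text \<open>The distances \<open>1, \<dots>, k - 1\<close> contribute a geometric series with ratio \<open>\<bar>\<mu>\<bar>\<close>, and the distance
  \<open>k\<close> contributes the truncation term.\<close>

lemma sum_cmod_defect:
  assumes k: "1 \<le> k" and \<mu>: "cmod \<mu> < 1"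
  shows "(\<Sum>d=1..k. cmod (defect k \<Lambda> \<mu> d)) =
    cmod (\<Lambda> - \<mu>) * (1 - cmod \<mu> ^ (k - 1)) / (1 - cmod \<mu>) + cmod (\<Lambda> * \<mu> ^ (k - 1))"
proof -
  have split: "{1..k} = insert k (Suc ` {..<k - 1})"
    using k by (auto simp: image_Suc_lessThan)
  have "(\<Sum>d=1..k. cmod (defect k \<Lambda> \<mu> d)) =
      cmod (defect k \<Lambda> \<mu> k) + (\<Sum>d\<in>Suc ` {..<k - 1}. cmod (defect k \<Lambda> \<mu> d))"
    using k unfolding split by (subst sum.insert) auto
  also have "(\<Sum>d\<in>Suc ` {..<k - 1}. cmod (defect k \<Lambda> \<mu> d)) =
      (\<Sum>d<k - 1. cmod \<mu> ^ d * cmod (\<Lambda> - \<mu>))"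
    by (subst sum.reindex) (auto simp: defect_def norm_mult norm_power intro!: sum.cong)
  also have "\<dots> = cmod (\<Lambda> - \<mu>) * (1 - cmod \<mu> ^ (k - 1)) / (1 - cmod \<mu>)"
    using \<mu> by (simp add: sum_gp_strict flip: sum_distrib_right)
  finally show ?thesis using k by (simp add: defect_def mult.commute)
qed

text \<open>With \<open>h q = p - q\<close> for fixed \<open>p\<close>, or \<open>h p = p - q\<close> for fixed \<open>q\<close>, the left-hand side is a row
  sum or a column sum of the Toeplitz matrix of a mode: every positive distance occurs at most
  once in it.\<close>

lemma sum_cmod_defect_le:
  assumes k: "1 \<le> k" and \<mu>: "cmod \<mu> < 1" and A: "finite A" and inj: "inj_on h {x \<in> A. 0 < h x}"
  shows "(\<Sum>x\<in>A. cmod (defect k \<Lambda> \<mu> (h x))) \<le>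
    cmod (\<Lambda> - \<mu>) * (1 - cmod \<mu> ^ (k - 1)) / (1 - cmod \<mu>) + cmod (\<Lambda> * \<mu> ^ (k - 1))"
proof -
  let ?S = "{x \<in> A. h x \<in> {1..k}}"
  have "(\<Sum>x\<in>A. cmod (defect k \<Lambda> \<mu> (h x))) = (\<Sum>x\<in>?S. cmod (defect k \<Lambda> \<mu> (h x)))"
    using A by (intro sum.mono_neutral_right) (auto simp: defect_def)
  also have "\<dots> = (\<Sum>d\<in>h ` ?S. cmod (defect k \<Lambda> \<mu> d))"
    by (subst sum.reindex) (auto intro: inj_on_subset[OF inj])
  also have "\<dots> \<le> (\<Sum>d=1..k. cmod (defect k \<Lambda> \<mu> d))"
    by (intro sum_mono2) auto
  finally show ?thesis by (simp only: sum_cmod_defect[OF k \<mu>])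
qed

section \<open>The norm weighted by an inverse Gram matrix\<close>

text \<open>Splitting each coefficient as \<open>\<bar>t\<bar> = sqrt \<bar>t\<bar> * sqrt \<bar>t\<bar>\<close> before Cauchy-Schwarz spends one
  factor on the row sum and keeps the other for the column sum.\<close>

lemma schur_test:
  fixes t :: "nat \<Rightarrow> nat \<Rightarrow> complex" and y :: "nat \<Rightarrow> complex"
  assumes rows: "\<And>p. p < N \<Longrightarrow> (\<Sum>q<N. cmod (t p q)) \<le> C"
    and cols: "\<And>q. q < N \<Longrightarrow> (\<Sum>p<N. cmod (t p q)) \<le> C"
    and C: "0 \<le> C"
  shows "(\<Sum>p<N. (cmod (\<Sum>q<N. t p q * y q))\<^sup>2) \<le> C\<^sup>2 * (\<Sum>q<N. (cmod (y q))\<^sup>2)"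
proof -
  have row: "(cmod (\<Sum>q<N. t p q * y q))\<^sup>2 \<le> C * (\<Sum>q<N. cmod (t p q) * (cmod (y q))\<^sup>2)"
    if p: "p < N" for p
  proof -
    have "cmod (\<Sum>q<N. t p q * y q) \<le> (\<Sum>q<N. cmod (t p q) * cmod (y q))"
      by (rule order_trans[OF norm_sum]) (simp add: norm_mult)
    then have "(cmod (\<Sum>q<N. t p q * y q))\<^sup>2 \<le> (\<Sum>q<N. cmod (t p q) * cmod (y q))\<^sup>2"
      by (intro power_mono) auto
    also have "\<dots> = (\<Sum>q<N. sqrt (cmod (t p q)) * (sqrt (cmod (t p q)) * cmod (y q)))\<^sup>2"
      by (simp flip: mult.assoc)
    also have "\<dots> \<le> (\<Sum>q<N. (sqrt (cmod (t p q)))\<^sup>2) *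
        (\<Sum>q<N. (sqrt (cmod (t p q)) * cmod (y q))\<^sup>2)"
      by (rule Cauchy_Schwarz_ineq_sum)
    also have "\<dots> = (\<Sum>q<N. cmod (t p q)) * (\<Sum>q<N. cmod (t p q) * (cmod (y q))\<^sup>2)"
      by (simp add: power_mult_distrib)
    also have "\<dots> \<le> C * (\<Sum>q<N. cmod (t p q) * (cmod (y q))\<^sup>2)"
      by (intro mult_right_mono rows p sum_nonneg) auto
    finally show ?thesis .
  qed
  have "(\<Sum>p<N. (cmod (\<Sum>q<N. t p q * y q))\<^sup>2) \<le>
      (\<Sum>p<N. C * (\<Sum>q<N. cmod (t p q) * (cmod (y q))\<^sup>2))"
    by (intro sum_mono row) simp
  also have "\<dots> = C * (\<Sum>p<N. \<Sum>q<N. cmod (t p q) * (cmod (y q))\<^sup>2)"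
    by (simp add: sum_distrib_left)
  also have "(\<Sum>p<N. \<Sum>q<N. cmod (t p q) * (cmod (y q))\<^sup>2) =
      (\<Sum>q<N. \<Sum>p<N. cmod (t p q) * (cmod (y q))\<^sup>2)"
    by (rule sum.swap)
  also have "\<dots> = (\<Sum>q<N. (\<Sum>p<N. cmod (t p q)) * (cmod (y q))\<^sup>2)"
    by (simp add: sum_distrib_right)
  also have "C * \<dots> \<le> C * (\<Sum>q<N. C * (cmod (y q))\<^sup>2)"
    using C by (intro mult_left_mono sum_mono mult_right_mono cols) auto
  also have "\<dots> = C\<^sup>2 * (\<Sum>q<N. (cmod (y q))\<^sup>2)"
    by (simp add: sum_distrib_left power2_eq_square mult.assoc)
  finally show ?thesis .
qed

text \<open>The recursive block diagonal matrix has the uniform block layout used for all other operators,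
  which gives access to its entries.\<close>

lemma diag_block_mat_replicate:
  assumes A: "A \<in> carrier_mat n n" and n: "0 < n"
  shows "diag_block_mat (replicate r A) = block_mat n r r (\<lambda>p q. if p = q then A else 0\<^sub>m n n)"
proof (induction r)
  case 0
  show ?case by (intro eq_matI) auto
next
  case (Suc r)
  let ?B = "\<lambda>r. block_mat n r r (\<lambda>p q. if p = q then A else 0\<^sub>m n n)"
  have sub: "i div n = Suc ((i - n) div n)" "i mod n = (i - n) mod n" if "n \<le> i" for i
    using that n by (simp_all add: div_if mod_if)
  have "diag_block_mat (replicate (Suc r) A) =
      four_block_mat A (0\<^sub>m n (r * n)) (0\<^sub>m (r * n) n) (?B r)"
    using A by (simp add: Let_def Suc)
  also have "\<dots> = ?B (Suc r)"
  proof (intro eq_matI)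
    fix i j assume "i < dim_row (?B (Suc r))" "j < dim_col (?B (Suc r))"
    then have ij: "i < Suc r * n" "j < Suc r * n" by simp_all
    have md: "i mod n < n" "j mod n < n" using n by auto
    show "four_block_mat A (0\<^sub>m n (r * n)) (0\<^sub>m (r * n) n) (?B r) $$ (i, j) = ?B (Suc r) $$ (i, j)"
      using ij A md by (cases "i < n"; cases "j < n")
        (auto simp: block_mat_index sub)
  qed (use A in simp_all)
  finally show ?case .
qed

lemma diag_block_mat_replicate_mult:
  assumes A: "A \<in> carrier_mat n n" and B: "B \<in> carrier_mat n n" and AB: "A * B = 1\<^sub>m n" and n: "0 < n"
  shows "diag_block_mat (replicate r A) * diag_block_mat (replicate r B) = (1\<^sub>m (r * n) :: complex mat)"
proof (induction r)
  case (Suc r)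
  let ?A = "diag_block_mat (replicate r A)" and ?B = "diag_block_mat (replicate r B)"
  have car: "?A \<in> carrier_mat (r * n) (r * n)" "?B \<in> carrier_mat (r * n) (r * n)"
    using A B n by (simp_all add: diag_block_mat_replicate)
  have "diag_block_mat (replicate (Suc r) A) * diag_block_mat (replicate (Suc r) B) =
     four_block_mat A (0\<^sub>m n (r * n)) (0\<^sub>m (r * n) n) ?A * four_block_mat B (0\<^sub>m n (r * n)) (0\<^sub>m (r * n) n) ?B"
    using A B car by (simp add: Let_def)
  also have "\<dots> = four_block_mat (1\<^sub>m n) (0\<^sub>m n (r * n)) (0\<^sub>m (r * n) n) (1\<^sub>m (r * n))"
    using A B car AB Suc by (subst mult_four_block_mat[of _ n n _ "r * n" _ "r * n" _ _ n _ "r * n"]) auto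
  also have "\<dots> = 1\<^sub>m (Suc r * n)" by (intro eq_matI) auto
  finally show ?case .
qed (auto intro!: eq_matI)

lemma mat_adjoint_dim [simp]:
  "dim_row (mat_adjoint A) = dim_col A" "dim_col (mat_adjoint A) = dim_row A"
  by (simp_all add: mat_adjoint_def)

lemma mat_adjoint_carrier [simp]: "A \<in> carrier_mat r c \<Longrightarrow> mat_adjoint A \<in> carrier_mat c r"
  by (auto simp: mat_adjoint_def)

lemma mat_adjoint_index:
  fixes A :: "complex mat"
  assumes "A \<in> carrier_mat r c" "i < c" "j < r"
  shows "mat_adjoint A $$ (i, j) = cnj (A $$ (j, i))"
  using assms by (auto simp: mat_adjoint_def mat_of_rows_def)

lemma mat_adjoint_mult:
  fixes A B :: "complex mat"
  assumes A: "A \<in> carrier_mat r s" and B: "B \<in> carrier_mat s c"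
  shows "mat_adjoint (A * B) = mat_adjoint B * mat_adjoint A"
proof -
  have "mat_adjoint (A * B) $$ (i, j) = (mat_adjoint B * mat_adjoint A) $$ (i, j)"
    if "i < c" "j < r" for i j
    using that A B by (simp add: mat_adjoint_index[OF mult_carrier_mat[OF A B]]
      mat_adjoint_index[OF A] mat_adjoint_index[OF B] scalar_prod_def mult.commute)
  then show ?thesis using A B by (intro eq_matI) auto
qed

lemma mat_adjoint_one: "mat_adjoint (1\<^sub>m r :: complex mat) = 1\<^sub>m r"
  by (intro eq_matI) (auto simp: mat_adjoint_index[OF one_carrier_mat])

lemma mat_adjoint_cscalar_prod:
  fixes A :: "complex mat"
  assumes A: "A \<in> carrier_mat r c" and w: "w \<in> carrier_vec r" and x: "x \<in> carrier_vec c"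
  shows "(mat_adjoint A *\<^sub>v w) \<bullet>c x = w \<bullet>c (A *\<^sub>v x)"
proof -
  have "(mat_adjoint A *\<^sub>v w) \<bullet>c x = (\<Sum>i<c. (\<Sum>j<r. cnj (A $$ (j, i)) * w $ j) * cnj (x $ i))"
    using A w x by (simp add: scalar_prod_def lessThan_atLeast0 mat_adjoint_index[OF A])
  also have "\<dots> = (\<Sum>i<c. \<Sum>j<r. w $ j * (cnj (A $$ (j, i)) * cnj (x $ i)))"
    by (simp add: sum_distrib_left sum_distrib_right mult_ac)
  also have "\<dots> = (\<Sum>j<r. \<Sum>i<c. w $ j * (cnj (A $$ (j, i)) * cnj (x $ i)))"
    by (rule sum.swap)
  also have "\<dots> = w \<bullet>c (A *\<^sub>v x)"
    using A w x by (simp add: scalar_prod_def lessThan_atLeast0 sum_distrib_left)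
  finally show ?thesis .
qed

text \<open>With \<open>Z = W\<inverse>\<close> the weight is \<open>(W W\<^sup>*)\<inverse> = Z\<^sup>* Z\<close>, and \<open>x\<^sup>* Z\<^sup>* Z x\<close> is the squared
  Euclidean norm of \<open>Z x\<close>.\<close>

lemma weighted_vec_norm_inverse_gram:
  assumes W: "W \<in> carrier_mat r r" and Z: "Z \<in> carrier_mat r r" and WZ: "W * Z = 1\<^sub>m r"
    and x: "x \<in> carrier_vec r"
  shows "weighted_vec_norm (mat_inv (W * mat_adjoint W)) x = sqrt (\<Sum>i<r. (cmod ((Z *\<^sub>v x) $ i))\<^sup>2)"
proof -
  note W' = mat_adjoint_carrier[OF W] and Z' = mat_adjoint_carrier[OF Z]
  have ZW: "Z * W = 1\<^sub>m r" by (rule mat_mult_left_right_inverse[OF W Z WZ])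
  have "W * mat_adjoint W * (mat_adjoint Z * Z) = W * (mat_adjoint W * mat_adjoint Z) * Z"
    using assoc_mult_mat[OF mult_carrier_mat[OF W W'] Z' Z] assoc_mult_mat[OF W W' Z'] by simp
  also have "mat_adjoint W * mat_adjoint Z = 1\<^sub>m r"
    by (simp add: mat_adjoint_mult[OF Z W, symmetric] ZW mat_adjoint_one)
  also have "W * 1\<^sub>m r * Z = 1\<^sub>m r" using W WZ by simp
  finally have inv: "mat_inv (W * mat_adjoint W) = mat_adjoint Z * Z"
    using W Z W' Z' by (intro mat_inv_eqI[of _ r]) auto
  have "(mat_adjoint Z * Z *\<^sub>v x) \<bullet>c x = (Z *\<^sub>v x) \<bullet>c (Z *\<^sub>v x)"
    using Z x Z' by (simp add: assoc_mult_mat_vec[OF Z' Z x] mat_adjoint_cscalar_prod)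
  also have "\<dots> = (\<Sum>i<r. complex_of_real ((cmod ((Z *\<^sub>v x) $ i))\<^sup>2))"
    using Z x by (simp add: scalar_prod_def lessThan_atLeast0 complex_norm_square
        del: index_mult_mat_vec of_real_power)
  finally show ?thesis by (simp add: weighted_vec_norm_def inv flip: of_real_sum)
qed

context eigenbasis
begin

lemma modal_coordinates:
  assumes x: "x \<in> carrier_vec (r * n)" and p: "p < r" and e: "e < n"
  shows "(diag_block_mat (replicate r V) *\<^sub>v x) $ (p * n + e) = (\<Sum>b<n. V $$ (e, b) * x $ (p * n + b))"
proof -
  have "(diag_block_mat (replicate r V) *\<^sub>v x) $ (p * n + e) =
      (\<Sum>t<r * n. (if p = t div n then V $$ (e, t mod n) * x $ (t div n * n + t mod n) else 0))"
    using x p e block_index_less[OF p e] n_pos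
    by (auto simp: diag_block_mat_replicate[OF V n_pos] scalar_prod_def lessThan_atLeast0
        block_mat_index intro!: sum.cong)
  also have "\<dots> = (\<Sum>q<r. \<Sum>b<n. if p = q then V $$ (e, b) * x $ (q * n + b) else 0)"
    by (rule sum_div_mod[OF n_pos])
  also have "\<dots> = (\<Sum>q<r. if p = q then \<Sum>b<n. V $$ (e, b) * x $ (q * n + b) else 0)"
    by (intro sum.cong) auto
  finally show ?thesis using p by simp
qed

text \<open>In the coordinates \<open>V\<close> supplies, a modal matrix acts on each mode by its own scalar matrix.\<close>

lemma modal_coordinates_modal:
  assumes x: "x \<in> carrier_vec (r * n)" and p: "p < r" and e: "e < n"
  shows "(diag_block_mat (replicate r V) *\<^sub>v (modal r r g *\<^sub>v x)) $ (p * n + e) =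
    (\<Sum>q<r. g e p q * (diag_block_mat (replicate r V) *\<^sub>v x) $ (q * n + e))"
proof -
  let ?y = "\<lambda>q e. \<Sum>b<n. V $$ (e, b) * x $ (q * n + b)"
  have gx: "(modal r r g *\<^sub>v x) $ (p * n + b) = (\<Sum>e'<n. U $$ (b, e') * (\<Sum>q<r. g e' p q * ?y q e'))"
    if b: "b < n" for b
  proof -
    have "(modal r r g *\<^sub>v x) $ (p * n + b) =
        (\<Sum>t<r * n. spectral (\<lambda>e. g e p (t div n)) $$ (b, t mod n) * x $ (t div n * n + t mod n))"
      using x p b block_index_less[OF p b] 
      by (auto simp: modal_def scalar_prod_def lessThan_atLeast0 block_mat_index intro!: sum.cong)
    also have "\<dots> = (\<Sum>q<r. \<Sum>c<n. spectral (\<lambda>e. g e p q) $$ (b, c) * x $ (q * n + c))"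
      by (rule sum_div_mod[OF n_pos])
    also have "\<dots> = (\<Sum>q<r. \<Sum>c<n. \<Sum>e'<n. U $$ (b, e') * (g e' p q * (V $$ (e', c) * x $ (q * n + c))))"
      using b by (simp add: spectral_index sum_distrib_right mult.assoc)
    also have "\<dots> = (\<Sum>q<r. \<Sum>e'<n. \<Sum>c<n. U $$ (b, e') * (g e' p q * (V $$ (e', c) * x $ (q * n + c))))"
      by (intro sum.cong refl sum.swap)
    also have "\<dots> = (\<Sum>e'<n. \<Sum>q<r. \<Sum>c<n. U $$ (b, e') * (g e' p q * (V $$ (e', c) * x $ (q * n + c))))"
      by (rule sum.swap)
    finally show ?thesis by (simp add: sum_distrib_left)
  qed
  have "(diag_block_mat (replicate r V) *\<^sub>v (modal r r g *\<^sub>v x)) $ (p * n + e) =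
      (\<Sum>b<n. V $$ (e, b) * (\<Sum>e'<n. U $$ (b, e') * (\<Sum>q<r. g e' p q * ?y q e')))"
    using mult_mat_vec_carrier[OF modal_carrier x] p e by (simp add: modal_coordinates gx)
  also have "\<dots> = (\<Sum>b<n. \<Sum>e'<n. V $$ (e, b) * U $$ (b, e') * (\<Sum>q<r. g e' p q * ?y q e'))"
    by (simp only: sum_distrib_left[of "V $$ _"] mult.assoc)
  also have "\<dots> = (\<Sum>e'<n. \<Sum>b<n. V $$ (e, b) * U $$ (b, e') * (\<Sum>q<r. g e' p q * ?y q e'))"
    by (rule sum.swap)
  also have "\<dots> = (\<Sum>e'<n. (if e = e' then 1 else 0) * (\<Sum>q<r. g e' p q * ?y q e'))"
    using e by (simp add: VU_sum flip: sum_distrib_right)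
  also have "\<dots> = (\<Sum>e'<n. if e = e' then (\<Sum>q<r. g e' p q * ?y q e') else 0)"
    by (intro sum.cong) auto
  also have "\<dots> = (\<Sum>q<r. g e p q * ?y q e)" using e by simp
  finally show ?thesis using x e by (simp add: modal_coordinates)
qed

text \<open>The squared weighted norm is a sum over modes, so it suffices to apply the Schur test to each
  mode separately with a common constant.\<close>

lemma weighted_op_norm_modal_le:
  assumes r: "0 < r" and C: "0 \<le> C"
    and rows: "\<And>e p. e < n \<Longrightarrow> p < r \<Longrightarrow> (\<Sum>q<r. cmod (g e p q)) \<le> C"
    and cols: "\<And>e q. e < n \<Longrightarrow> q < r \<Longrightarrow> (\<Sum>p<r. cmod (g e p q)) \<le> C"
  defines "W \<equiv> diag_block_mat (replicate r U)"
  shows "weighted_op_norm (mat_inv (W * mat_adjoint W)) (modal r r g) \<le> C"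
proof -
  define Z where "Z = diag_block_mat (replicate r V)"
  have WZ: "W \<in> carrier_mat (r * n) (r * n)" "Z \<in> carrier_mat (r * n) (r * n)" "W * Z = 1\<^sub>m (r * n)"
    unfolding W_def Z_def using U V UV n_pos
    by (simp_all add: diag_block_mat_replicate_mult) (simp_all add: diag_block_mat_replicate)
  let ?norm = "weighted_vec_norm (mat_inv (W * mat_adjoint W))"
  have norm: "?norm x = sqrt (\<Sum>e<n. \<Sum>p<r. (cmod ((Z *\<^sub>v x) $ (p * n + e)))\<^sup>2)"
    if "x \<in> carrier_vec (r * n)" for x
  proof -
    have "(\<Sum>i<r * n. (cmod ((Z *\<^sub>v x) $ (i div n * n + i mod n)))\<^sup>2) =
        (\<Sum>p<r. \<Sum>e<n. (cmod ((Z *\<^sub>v x) $ (p * n + e)))\<^sup>2)"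
      by (rule sum_div_mod[OF n_pos])
    also have "\<dots> = (\<Sum>e<n. \<Sum>p<r. (cmod ((Z *\<^sub>v x) $ (p * n + e)))\<^sup>2)"
      by (rule sum.swap)
    finally show ?thesis
      using weighted_vec_norm_inverse_gram[OF WZ that] by simp
  qed
  have bound: "?norm (modal r r g *\<^sub>v x) \<le> C * ?norm x" if x: "x \<in> carrier_vec (r * n)" for x
  proof -
    have "(\<Sum>p<r. (cmod ((Z *\<^sub>v (modal r r g *\<^sub>v x)) $ (p * n + e)))\<^sup>2) \<le>
        C\<^sup>2 * (\<Sum>p<r. (cmod ((Z *\<^sub>v x) $ (p * n + e)))\<^sup>2)" if e: "e < n" for e
      using schur_test[OF rows[OF e] cols[OF e] C, where y = "\<lambda>q. (Z *\<^sub>v x) $ (q * n + e)"]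
        modal_coordinates_modal[OF x _ e]
      unfolding Z_def by simp
    then have "(\<Sum>e<n. \<Sum>p<r. (cmod ((Z *\<^sub>v (modal r r g *\<^sub>v x)) $ (p * n + e)))\<^sup>2) \<le>
        C\<^sup>2 * (\<Sum>e<n. \<Sum>p<r. (cmod ((Z *\<^sub>v x) $ (p * n + e)))\<^sup>2)"
      unfolding sum_distrib_left[of "C\<^sup>2" _ "{..<n}"] by (intro sum_mono) simp
    then have "sqrt (\<Sum>e<n. \<Sum>p<r. (cmod ((Z *\<^sub>v (modal r r g *\<^sub>v x)) $ (p * n + e)))\<^sup>2) \<le>
        sqrt (C\<^sup>2 * (\<Sum>e<n. \<Sum>p<r. (cmod ((Z *\<^sub>v x) $ (p * n + e)))\<^sup>2))"
      by (rule real_sqrt_le_mono)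
    then show ?thesis
      using C by (simp add: norm x mult_mat_vec_carrier[OF modal_carrier x] real_sqrt_mult)
  qed
  have dim: "dim_col (modal r r g) = r * n" by (simp add: modal_def)
  have "unit_vec (r * n) 0 \<in> carrier_vec (r * n) - {0\<^sub>v (r * n) :: complex vec}"
    using r n_pos by (auto simp: vec_eq_iff)
  then have "carrier_vec (r * n) - {0\<^sub>v (r * n) :: complex vec} \<noteq> {}" by blast
  then show ?thesis unfolding weighted_op_norm_def dim
  proof (rule cSUP_least)
    fix x :: "complex vec" assume "x \<in> carrier_vec (r * n) - {0\<^sub>v (r * n)}"
    then have x: "x \<in> carrier_vec (r * n)" by simp
    have "0 \<le> ?norm x" by (simp add: norm[OF x] sum_nonneg)
    then show "?norm (modal r r g *\<^sub>v x) / ?norm x \<le> C"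
      using bound[OF x] C by (cases "?norm x = 0") (auto simp: divide_simps)
  qed
qed

end

section \<open>Reordering by the CF-splitting\<close>

text \<open>With a zero first block column, each further factor multiplies both surviving blocks by \<open>D\<close> from
  the right.\<close>

lemma four_block_mat_zero_column_pow:
  fixes B D :: "complex mat"
  assumes B: "B \<in> carrier_mat s t" and D: "D \<in> carrier_mat t t" and l: "1 \<le> l"
  shows "four_block_mat (0\<^sub>m s s) B (0\<^sub>m t s) D ^\<^sub>m l =
    four_block_mat (0\<^sub>m s s) (B * D ^\<^sub>m (l - 1)) (0\<^sub>m t s) (D ^\<^sub>m l)"
  using l
proof (induction l rule: dec_induct)
  case base
  show ?case using B D by simp
next
  case (step l)
  have Dp: "D ^\<^sub>m j \<in> carrier_mat t t" for j using D by simp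
  have "B * D ^\<^sub>m (l - 1) * D = B * D ^\<^sub>m l"
    using assoc_mult_mat[OF B Dp D, of "l - 1"] step.hyps by (cases l) simp_all
  then show ?case using step B D Dp mult_carrier_mat[OF B Dp]
    by (simp, subst mult_four_block_mat[of _ s s _ t _ t _ _ s _ t]) auto
qed

lemma cf_order:
  "distinct (F_points m Nt @ C_points m Nt)" "set (F_points m Nt @ C_points m Nt) = {..<Nt + 1}"
  "length (F_points m Nt @ C_points m Nt) = Nt + 1"
proof -
  show "distinct (F_points m Nt @ C_points m Nt)" "set (F_points m Nt @ C_points m Nt) = {..<Nt + 1}"
    by (auto simp: F_points_def C_points_def simp del: upt_Suc)
  then show "length (F_points m Nt @ C_points m Nt) = Nt + 1"
    by (metis card_lessThan distinct_card)
qed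

lemma C_points_eq:
  assumes N: "Nt + 1 = m * (NT + 1)" and m: "0 < m"
  shows "C_points m Nt = map (\<lambda>p. p * m) [0..<NT + 1]"
proof (rule sorted_distinct_set_unique)
  have less: "p * m < m * (NT + 1) \<longleftrightarrow> p < NT + 1" for p
    by (simp only: mult.commute[of m] mult_less_cancel2 m simp_thms)
  show "sorted (C_points m Nt)" "distinct (C_points m Nt)"
    by (simp_all add: C_points_def sorted_wrt_filter del: upt_Suc)
  show "sorted (map (\<lambda>p. p * m) [0..<NT + 1])" "distinct (map (\<lambda>p. p * m) [0..<NT + 1])"
    using m by (simp_all add: sorted_iff_nth_mono distinct_map inj_on_def del: upt_Suc)
  have "i \<in> set (C_points m Nt) \<longleftrightarrow> i \<in> set (map (\<lambda>p. p * m) [0..<NT + 1])" for i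
  proof -
    have "i \<in> set (C_points m Nt) \<longleftrightarrow> i < m * (NT + 1) \<and> (\<exists>p. i = p * m)"
      unfolding C_points_def N dvd_def mult.commute[of m] by simp
    also have "\<dots> \<longleftrightarrow> (\<exists>p<NT + 1. i = p * m)" using less by blast
    finally show ?thesis by (simp add: image_iff Bex_def del: upt_Suc)
  qed
  then show "set (C_points m Nt) = set (map (\<lambda>p. p * m) [0..<NT + 1])" by blast
qed

lemma cf_reorder_index:
  assumes "0 < n" "i < (Nt + 1) * n" "j < (Nt + 1) * n"
  shows "cf_reorder n m Nt X $$ (i, j) =
    X $$ ((F_points m Nt @ C_points m Nt) ! (i div n) * n + i mod n,
          (F_points m Nt @ C_points m Nt) ! (j div n) * n + j mod n)"
  using assms by (simp add: cf_reorder_def block_mat_index block_at_def Let_def)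

lemma cf_reorder_carrier [simp]: "cf_reorder n m Nt X \<in> carrier_mat ((Nt + 1) * n) ((Nt + 1) * n)"
  unfolding cf_reorder_def Let_def by (rule block_mat_carrier)

lemma cf_order_nth_less: "i < Nt + 1 \<Longrightarrow> (F_points m Nt @ C_points m Nt) ! i < Nt + 1"
  using cf_order[of m Nt] nth_mem by (metis lessThan_iff)

text \<open>Reordering permutes the summation index of a matrix product, which does not change the sum.\<close>

lemma cf_reorder_mult:
  assumes n: "0 < n" and X: "X \<in> carrier_mat ((Nt + 1) * n) ((Nt + 1) * n)"
    and Y: "Y \<in> carrier_mat ((Nt + 1) * n) ((Nt + 1) * n)"
  shows "cf_reorder n m Nt (X * Y) = cf_reorder n m Nt X * cf_reorder n m Nt Y"
proof -
  define N where "N = Nt + 1"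
  define ord where "ord = F_points m Nt @ C_points m Nt"
  note index = cf_reorder_index[OF n, of _ Nt _ m, folded N_def ord_def]
  have carr: "cf_reorder n m Nt Z \<in> carrier_mat (N * n) (N * n)" for Z
    unfolding N_def by (rule cf_reorder_carrier)
  have bij: "bij_betw (\<lambda>l. ord ! l) {..<N} {..<N}"
    using bij_betw_nth[of ord "{..<N}" "{..<N}"] cf_order[of m Nt] unfolding ord_def N_def by simp
  have lt: "ord ! (i div n) * n + i mod n < N * n" if "i < N * n" for i
    using that n unfolding ord_def N_def
    by (intro block_index_less cf_order_nth_less) (auto simp: less_mult_imp_div_less)
  have "cf_reorder n m Nt (X * Y) $$ (i, j) = (cf_reorder n m Nt X * cf_reorder n m Nt Y) $$ (i, j)"
    if i: "i < N * n" and j: "j < N * n" for i j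
  proof -
    let ?i = "ord ! (i div n) * n + i mod n" and ?j = "ord ! (j div n) * n + j mod n"
    have "cf_reorder n m Nt (X * Y) $$ (i, j) =
        (\<Sum>t<N * n. X $$ (?i, t div n * n + t mod n) * Y $$ (t div n * n + t mod n, ?j))"
      using X Y lt[OF i] lt[OF j] unfolding N_def[symmetric]
      by (simp add: index i j scalar_prod_def lessThan_atLeast0)
    also have "\<dots> = (\<Sum>l<N. \<Sum>b<n. X $$ (?i, l * n + b) * Y $$ (l * n + b, ?j))"
      by (rule sum_div_mod[OF n])
    also have "\<dots> = (\<Sum>l<N. \<Sum>b<n. X $$ (?i, ord ! l * n + b) * Y $$ (ord ! l * n + b, ?j))"
      by (rule sum.reindex_bij_betw[OF bij, symmetric])
    also have "\<dots> = (\<Sum>t<N * n. X $$ (?i, ord ! (t div n) * n + t mod n) *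
        Y $$ (ord ! (t div n) * n + t mod n, ?j))"
      by (rule sum_div_mod[OF n, symmetric])
    also have "\<dots> = (cf_reorder n m Nt X * cf_reorder n m Nt Y) $$ (i, j)"
      using carr[of X] carr[of Y] i j
      by (simp add: index scalar_prod_def lessThan_atLeast0)
    finally show ?thesis .
  qed
  then show ?thesis using carr[of X] carr[of Y] carr[of "X * Y"] by (intro eq_matI) auto
qed

lemma cf_reorder_block_mat:
  assumes n: "0 < n"
  shows "cf_reorder n m Nt (block_mat n (Nt + 1) (Nt + 1) B) = block_mat n (Nt + 1) (Nt + 1)
    (\<lambda>i j. Matrix.mat n n (($$) (B ((F_points m Nt @ C_points m Nt) ! i) ((F_points m Nt @ C_points m Nt) ! j))))"
  unfolding cf_reorder_def Let_def
proof (rule block_mat_cong)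
  fix i j assume "i < Nt + 1" "j < Nt + 1"
  then show "block_at n (block_mat n (Nt + 1) (Nt + 1) B) ((F_points m Nt @ C_points m Nt) ! i)
      ((F_points m Nt @ C_points m Nt) ! j) = Matrix.mat n n
      (($$) (B ((F_points m Nt @ C_points m Nt) ! i) ((F_points m Nt @ C_points m Nt) ! j)))"
    using cf_order_nth_less[of i Nt m] cf_order_nth_less[of j Nt m]
    unfolding block_at_def by (intro eq_matI) (simp_all add: block_mat_index_block del: Suc_eq_plus1)
qed

text \<open>The identity is block diagonal with equal blocks; the trivial eigenbasis makes its modal
  description available.\<close>

lemma cf_reorder_one:
  assumes n: "0 < n"
  shows "cf_reorder n m Nt (1\<^sub>m ((Nt + 1) * n)) = 1\<^sub>m ((Nt + 1) * n)"
proof -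
  interpret eigenbasis n "1\<^sub>m n" "1\<^sub>m n" by unfold_locales (use n in auto)
  let ?ord = "F_points m Nt @ C_points m Nt"
  have "cf_reorder n m Nt (modal (Nt + 1) (Nt + 1) (\<lambda>e i j. if i = j then 1 else 0)) =
      block_mat n (Nt + 1) (Nt + 1) (\<lambda>i j. Matrix.mat n n (($$) (spectral (\<lambda>e. if ?ord ! i = ?ord ! j then 1 else 0))))"
    unfolding modal_def cf_reorder_block_mat[OF n] ..
  also have "\<dots> = modal (Nt + 1) (Nt + 1) (\<lambda>e i j. if i = j then 1 else 0)"
    using cf_order[of m Nt]
    by (intro block_mat_eq_modal eq_matI) (auto simp: nth_eq_iff_index_eq)
  finally show ?thesis by (simp only: modal_one)
qed

lemma cf_reorder_pow:
  assumes n: "0 < n" and X: "X \<in> carrier_mat ((Nt + 1) * n) ((Nt + 1) * n)"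
  shows "cf_reorder n m Nt (X ^\<^sub>m l) = cf_reorder n m Nt X ^\<^sub>m l"
proof (induction l)
  case 0
  have "dim_row X = (Nt + 1) * n" "dim_row (cf_reorder n m Nt X) = (Nt + 1) * n"
    using X cf_reorder_carrier by blast+
  then show ?case by (simp only: pow_mat.simps cf_reorder_one[OF n])
next
  case (Suc l)
  have "X ^\<^sub>m l \<in> carrier_mat ((Nt + 1) * n) ((Nt + 1) * n)" using X by (rule pow_carrier_mat)
  then show ?case using Suc by (simp only: pow_mat.simps cf_reorder_mult[OF n _ X])
qed

text \<open>In the reordered numbering the F-points come first, so the first block column of the partition
  consists of columns at F-points. The C-points follow in increasing order, so block \<open>(p, q)\<close> of
  \<open>E_cc\<close> is the block of \<open>E\<close> at the time points \<open>p m\<close> and \<open>q m\<close>.\<close>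

lemma (in eigenbasis) cf_partition_error_op:
  assumes N: "Nt + 1 = m * (NT + 1)" and m: "0 < m" and k: "1 \<le> k"
    and E: "E = error_op n m Nt NT k (spectral \<phi>) (spectral \<mu>)"
    and part: "cf_partition n m Nt E = (E_ff, E_fc, E_cf, E_cc)"
  defines "s \<equiv> length (F_points m Nt) * n" and "t \<equiv> (NT + 1) * n"
  shows "E_ff = 0\<^sub>m s s" "E_cf = 0\<^sub>m t s" "E_fc \<in> carrier_mat s t"
    "E_cc = modal (NT + 1) (NT + 1) (\<lambda>e p q. defect k (\<phi> e ^ m) (\<mu> e) (p - q))"
    "cf_reorder n m Nt E = four_block_mat E_ff E_fc E_cf E_cc"
proof -
  let ?F = "length (F_points m Nt)"
  define ord where "ord = F_points m Nt @ C_points m Nt"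
  define g where "g e i j = (if m dvd j then \<phi> e ^ (i mod m) *
      defect k (\<phi> e ^ m) (\<mu> e) (i div m - j div m) else 0)" for e i j
  have len: "Nt + 1 = ?F + (NT + 1)"
    using cf_order(3)[of m Nt] by (simp add: C_points_eq[OF N m])
  have ordF: "\<not> m dvd ord ! i" if "i < ?F" for i
    using that nth_mem[of i "F_points m Nt"] by (auto simp: ord_def nth_append F_points_def)
  have ordC: "ord ! (?F + p) = p * m" if "p < NT + 1" for p
    using that by (simp add: ord_def nth_append C_points_eq[OF N m] del: upt_Suc)
  have dim: "(Nt + 1) * n = s + t" unfolding len s_def t_def by (simp add: algebra_simps)
  have E_modal: "E = modal (Nt + 1) (Nt + 1) g"
    unfolding E error_op_modal[OF N m k] g_def ..
  have X: "cf_reorder n m Nt E \<in> carrier_mat (s + t) (s + t)"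
    using cf_reorder_carrier[of n m Nt E] by (simp only: dim)
  have index: "cf_reorder n m Nt E $$ (i, j) =
      spectral (\<lambda>e. g e (ord ! (i div n)) (ord ! (j div n))) $$ (i mod n, j mod n)"
    if "i < s + t" "j < s + t" for i j
    using that n_pos unfolding E_modal modal_def cf_reorder_block_mat[OF n_pos] ord_def[symmetric]
      dim[symmetric]
    by (subst block_mat_index) simp_all
  have parts: "E_ff = Matrix.mat s s (\<lambda>ij. cf_reorder n m Nt E $$ ij)"
    "E_fc = Matrix.mat s t (\<lambda>(i, j). cf_reorder n m Nt E $$ (i, j + s))"
    "E_cf = Matrix.mat t s (\<lambda>(i, j). cf_reorder n m Nt E $$ (i + s, j))"
    "E_cc = Matrix.mat t t (\<lambda>(i, j). cf_reorder n m Nt E $$ (i + s, j + s))"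
    using part X by (auto simp: cf_partition_def split_block_def Let_def s_def)
  have colF: "spectral (\<lambda>e. g e i (ord ! (j div n))) = 0\<^sub>m n n" if "j < s" for i j
    using that ordF[of "j div n"] by (simp add: s_def g_def less_mult_imp_div_less spectral_zero)
  show "E_ff = 0\<^sub>m s s" "E_cf = 0\<^sub>m t s"
    unfolding parts using n_pos by (auto intro!: eq_matI simp: index colF)
  show "E_fc \<in> carrier_mat s t" unfolding parts by simp
  show "cf_reorder n m Nt E = four_block_mat E_ff E_fc E_cf E_cc"
    unfolding parts using X by (intro eq_matI) auto
  have shift: "(i + s) div n = ?F + i div n" "(i + s) mod n = i mod n" for i
    unfolding s_def using n_pos by simp_all
  show "E_cc = modal (NT + 1) (NT + 1) (\<lambda>e p q. defect k (\<phi> e ^ m) (\<mu> e) (p - q))"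
  proof (intro eq_matI)
    fix i j
    assume "i < dim_row (modal (NT + 1) (NT + 1) (\<lambda>e p q. defect k (\<phi> e ^ m) (\<mu> e) (p - q)))"
      and "j < dim_col (modal (NT + 1) (NT + 1) (\<lambda>e p q. defect k (\<phi> e ^ m) (\<mu> e) (p - q)))"
    then have ij: "i < (NT + 1) * n" "j < (NT + 1) * n" by (simp_all add: modal_def)
    then have pq: "i div n < NT + 1" "j div n < NT + 1" by (simp_all only: less_mult_imp_div_less)
    have "E_cc $$ (i, j) =
        spectral (\<lambda>e. g e (i div n * m) (j div n * m)) $$ (i mod n, j mod n)"
      using ij unfolding parts t_def[symmetric]
      by (simp add: index shift ordC[OF pq(1)] ordC[OF pq(2)])
    then show "E_cc $$ (i, j) =
        modal (NT + 1) (NT + 1) (\<lambda>e p q. defect k (\<phi> e ^ m) (\<mu> e) (p - q)) $$ (i, j)"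
      unfolding modal_def block_mat_index[OF ij] using m by (simp add: g_def)
  qed (simp_all add: parts modal_def t_def)
qed

section \<open>Error propagation of AT-MGRIT\<close>

lemma simultaneously_diagonalized_by_eigenbasis:
  assumes n: "0 < n" and \<Phi>: "\<Phi> \<in> carrier_mat n n" and \<Psi>: "\<Psi> \<in> carrier_mat n n"
    and diag: "simultaneously_diagonalized_by \<Phi> \<Psi> U"
  obtains V \<phi> \<mu> where "eigenbasis n U V"
    "\<Phi> = eigenbasis.spectral n U V \<phi>" "\<Psi> = eigenbasis.spectral n U V \<mu>"
proof -
  from diag obtain V D D' where D: "diagonal_mat D" "diagonal_mat D'"
    and sim: "similar_mat_wit \<Phi> D U V" "similar_mat_wit \<Psi> D' U V"
    unfolding simultaneously_diagonalized_by_def by blast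
  note w = sim(1)[unfolded similar_mat_wit_def] and w' = sim(2)[unfolded similar_mat_wit_def]
  have carr: "D \<in> carrier_mat n n" "D' \<in> carrier_mat n n" "U \<in> carrier_mat n n" "V \<in> carrier_mat n n"
    and inv: "U * V = 1\<^sub>m n" "V * U = 1\<^sub>m n" and eqs: "\<Phi> = U * D * V" "\<Psi> = U * D' * V"
    using w w' \<Phi> \<Psi> by (auto simp: Let_def)
  interpret eigenbasis n U V by unfold_locales (use n carr inv in auto)
  have product: "(X * Y) $$ (a, b) = (\<Sum>c<n. X $$ (a, c) * Y $$ (c, b))"
    if "X \<in> carrier_mat n n" "Y \<in> carrier_mat n n" "a < n" "b < n" for X Y :: "complex mat" and a b
    using that by (simp add: scalar_prod_def lessThan_atLeast0)
  have diagonalization: "U * A * V = spectral (\<lambda>e. A $$ (e, e))"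
    if A: "A \<in> carrier_mat n n" "diagonal_mat A" for A
  proof (intro eq_matI)
    fix a b assume "a < dim_row (spectral (\<lambda>e. A $$ (e, e)))" "b < dim_col (spectral (\<lambda>e. A $$ (e, e)))"
    then have ab: "a < n" "b < n" by simp_all
    have "(U * A) $$ (a, e) = U $$ (a, e) * A $$ (e, e)" if e: "e < n" for e
    proof -
      have "(U * A) $$ (a, e) = (\<Sum>c<n. U $$ (a, c) * A $$ (c, e))"
        using ab e A carr by (intro product) auto
      also have "\<dots> = (\<Sum>c<n. if c = e then U $$ (a, e) * A $$ (e, e) else 0)"
        using e A by (intro sum.cong) (auto simp: diagonal_mat_def)
      finally show ?thesis using e by simp
    qed
    then have "(\<Sum>e<n. (U * A) $$ (a, e) * V $$ (e, b)) = spectral (\<lambda>e. A $$ (e, e)) $$ (a, b)"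
      using ab by (simp add: spectral_index)
    moreover have "(U * A * V) $$ (a, b) = (\<Sum>e<n. (U * A) $$ (a, e) * V $$ (e, b))"
      using ab A carr by (intro product) auto
    ultimately show "(U * A * V) $$ (a, b) = spectral (\<lambda>e. A $$ (e, e)) $$ (a, b)" by simp
  qed (use carr in simp_all)
  show ?thesis
    using that[OF eigenbasis_axioms] eqs diagonalization carr(1,2) D by blast
qed

theorem theorem1:
  fixes n m Nt NT k :: nat
    and \<Phi> \<Psi> U U_tilde E E_ff E_fc E_cf E_cc :: "complex mat"
  assumes "0 < n" and "1 < m" and "Nt + 1 = m * (NT + 1)"
    and "1 \<le> k" and "k \<le> NT + 1"
    and "\<Phi> \<in> carrier_mat n n" and "\<Psi> \<in> carrier_mat n n" and "U \<in> carrier_mat n n"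
    and "simultaneously_diagonalized_by \<Phi> \<Psi> U"
    and "U_tilde = diag_block_mat (replicate (NT + 1) U)"
    and "E = error_op n m Nt NT k \<Phi> \<Psi>"
    and "cf_partition n m Nt E = (E_ff, E_fc, E_cf, E_cc)"
  shows "(\<forall>l::nat. 1 \<le> l \<longrightarrow>
           cf_reorder n m Nt (E ^\<^sub>m l) = four_block_mat E_ff E_fc E_cf E_cc ^\<^sub>m l \<and>
           four_block_mat E_ff E_fc E_cf E_cc ^\<^sub>m l =
             four_block_mat
               (0\<^sub>m (dim_row E_ff) (dim_col E_ff)) (E_fc * E_cc ^\<^sub>m (l - 1))
               (0\<^sub>m (dim_row E_cf) (dim_col E_cf)) (E_cc ^\<^sub>m l)) \<and>
         ((\<forall>\<mu> \<in> spectrum \<Psi>. cmod \<mu> < 1) \<and> (\<forall>lam \<in> spectrum \<Phi>. cmod lam < 1) \<longrightarrow>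
           weighted_op_norm (mat_inv (U_tilde * mat_adjoint U_tilde)) E_cc
             \<le> Max ((\<lambda>(\<mu>, lam).
                   cmod (lam ^ m - \<mu>) * (1 - cmod \<mu> ^ (k - 1)) / (1 - cmod \<mu>)
                   + cmod (lam ^ m * \<mu> ^ (k - 1)))
                 ` shared_eigenpairs \<Phi> \<Psi> U))"
proof -
  have m: "0 < m" using assms(2) by simp
  obtain V \<phi> \<mu> where eb: "eigenbasis n U V"
    and \<Phi>: "\<Phi> = eigenbasis.spectral n U V \<phi>" and \<Psi>: "\<Psi> = eigenbasis.spectral n U V \<mu>"
    using simultaneously_diagonalized_by_eigenbasis assms(1,6,7,9) by metis
  interpret eigenbasis n U V by (rule eb)
  note parts = cf_partition_error_op[OF assms(3) m assms(4) assms(11)[unfolded \<Phi> \<Psi>] assms(12)]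
  have E: "E \<in> carrier_mat ((Nt + 1) * n) ((Nt + 1) * n)"
    unfolding assms(11) \<Phi> \<Psi> error_op_modal[OF assms(3) m assms(4)] by (rule modal_carrier)
  have Ecc: "E_cc \<in> carrier_mat ((NT + 1) * n) ((NT + 1) * n)"
    unfolding parts(4) by (rule modal_carrier)
  let ?bound = "\<lambda>(\<mu>, lam). cmod (lam ^ m - \<mu>) * (1 - cmod \<mu> ^ (k - 1)) / (1 - cmod \<mu>)
    + cmod (lam ^ m * \<mu> ^ (k - 1))"
  let ?C = "Max (?bound ` shared_eigenpairs \<Phi> \<Psi> U)"
  have powers: "cf_reorder n m Nt (E ^\<^sub>m l) = four_block_mat E_ff E_fc E_cf E_cc ^\<^sub>m l \<and>
      four_block_mat E_ff E_fc E_cf E_cc ^\<^sub>m l = four_block_mat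
        (0\<^sub>m (dim_row E_ff) (dim_col E_ff)) (E_fc * E_cc ^\<^sub>m (l - 1))
        (0\<^sub>m (dim_row E_cf) (dim_col E_cf)) (E_cc ^\<^sub>m l)" if l: "1 \<le> l" for l
    using four_block_mat_zero_column_pow[OF parts(3) Ecc l]
    by (simp only: cf_reorder_pow[OF assms(1) E] parts(5)) (simp only: parts(1,2) index_zero_mat)
  have norm: "weighted_op_norm (mat_inv (U_tilde * mat_adjoint U_tilde)) E_cc \<le> ?C"
    if stable: "\<forall>\<mu> \<in> spectrum \<Psi>. cmod \<mu> < 1"
  proof -
    have \<mu>: "cmod (\<mu> e) < 1" if "e < n" for e
      using stable spectral_in_spectrum[OF that] unfolding \<Psi> by blast
    have le: "?bound (\<mu> e, \<phi> e) \<le> ?C" if "e < n" for e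
      using that unfolding \<Phi> \<Psi> shared_eigenpairs_spectral by (intro Max_ge) auto
    \<comment> \<open>The maximum is over a nonempty set because there is at least the mode \<open>0\<close>.\<close>
    have "0 \<le> ?bound (\<mu> 0, \<phi> 0)"
      using \<mu>[OF n_pos] by (auto intro!: add_nonneg_nonneg divide_nonneg_nonneg mult_nonneg_nonneg
          simp: power_le_one)
    then have C: "0 \<le> ?C" using le[OF n_pos] by linarith
    show ?thesis
      unfolding assms(10) parts(4)
    proof (rule weighted_op_norm_modal_le)
      fix e p assume e: "e < n" "p < NT + 1"
      have "(\<Sum>q<NT + 1. cmod (defect k (\<phi> e ^ m) (\<mu> e) (p - q))) \<le> ?bound (\<mu> e, \<phi> e)"
        unfolding prod.case
        by (rule sum_cmod_defect_le[OF assms(4) \<mu>[OF e(1)]]) (auto simp: inj_on_def)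
      then show "(\<Sum>q<NT + 1. cmod (defect k (\<phi> e ^ m) (\<mu> e) (p - q))) \<le> ?C"
        using le[OF e(1)] by linarith
    next
      fix e q assume e: "e < n" "q < NT + 1"
      have "(\<Sum>p<NT + 1. cmod (defect k (\<phi> e ^ m) (\<mu> e) (p - q))) \<le> ?bound (\<mu> e, \<phi> e)"
        unfolding prod.case
        by (rule sum_cmod_defect_le[OF assms(4) \<mu>[OF e(1)]]) (auto simp: inj_on_def)
      then show "(\<Sum>p<NT + 1. cmod (defect k (\<phi> e ^ m) (\<mu> e) (p - q))) \<le> ?C"
        using le[OF e(1)] by linarith
    qed (use C in auto)
  qed
  show ?thesis using powers norm by blast
qed

end
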